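(* Let $n,r\ge 1$ and let $A_k,B_k,C_k,D_k,E_k\in\mathbb{C}^{n\times n}$ for $k=1,\dots,r$. The system $$\left\{\begin{array}{ll} A_kX_kB_k-C_kX_{k+1}D_k=E_k, & k=1,\dots,r-1,\\ A_rX_rB_r-C_rX_1D_r=E_r,\end{array}\right.$$ in the unknowns $X_1,\dots,X_r\in\mathbb{C}^{n\times n}$, is nonsingular if and only if the two formal matrix products $$C_r^{-1}A_rC_{r-1}^{-1}A_{r-1}\cdots C_1^{-1}A_1\qquad\text{and}\qquad D_rB_r^{-1}D_{r-1}B_{r-1}^{-1}\cdots D_1B_1^{-1}$$ are regular and have disjoint spectra.
   Context: A system of matrix equations is called nonsingular if it has a unique solution for every choice of the right-hand sides $E_1,\dots,E_r$. Formal matrix products (no matrix is assumed invertible). By the periodic Schur decomposition theorem, for any $M_k,N_k\in\mathbb{C}^{n\times n}$, $k=1,\dots,p$, there are unitary $Q_k,Z_k$ such that $Q_k^{\mathsf H}M_kZ_k=T_k$ and $Q_k^{\mathsf H}N_kZ_{k+1}=R_k$ are upper triangular for $k=1,\dots,p$, with $Z_{p+1}=Z_1$. Given the formal product $N_p^{-1}M_pN_{p-1}^{-1}M_{p-1}\cdots N_1^{-1}M_1$ and such a decomposition, the formal product is called singular if for some $i\in\{1,\dots,n\}$ one has $\prod_{k=1}^p(T_k)_{ii}=\prod_{k=1}^p(R_k)_{ii}=0$, and regular otherwise. If it is regular, its eigenvalues are $$\lambda_i=\frac{\prod_{k=1}^p(T_k)_{ii}}{\prod_{k=1}^p(R_k)_{ii}}\in\mathbb{C}\cup\{\infty\},\qquad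 i=1,\dots,n,$$ with $a/0=\infty$ for $a\ne0$; its spectrum is the set of its eigenvalues. (These notions do not depend on the chosen decomposition.) For a formal product $M_pN_{p-1}^{-1}M_{p-1}\cdots N_1^{-1}M_1N_p^{-1}$ (exponent $-1$ in even positions), regularity and eigenvalues are defined by the same formulas from the same matrices $T_k,R_k$. Thus the first product of the claim is the case $p=r$, $M_k=A_k$, $N_k=C_k$, while the second is the case $p=r$, $M_k=D_k$ for $k=1,\dots,r$, $N_k=B_{k+1}$ for $k=1,\dots,r-1$, $N_r=B_1$. *)

theory Defs
  imports Jordan_Normal_Form.Schur_Decomposition "HOL-Library.FuncSet"
begin

text \<open>Families of matrices are functions on \<open>nat\<close>, of which only the indices \<open>1, \<dots>, r\<close> (resp.
  \<open>1, \<dots>, p\<close>) matter; the rows and columns of a single matrix are numbered \<open>0, \<dots>, n - 1\<close>.\<close>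

definition sylvester_solution ::
  "nat \<Rightarrow> (nat \<Rightarrow> complex mat) \<Rightarrow> (nat \<Rightarrow> complex mat) \<Rightarrow> (nat \<Rightarrow> complex mat) \<Rightarrow> (nat \<Rightarrow> complex mat)
    \<Rightarrow> (nat \<Rightarrow> complex mat) \<Rightarrow> (nat \<Rightarrow> complex mat) \<Rightarrow> bool" where
  "sylvester_solution r A B C D E X \<longleftrightarrow>
     (\<forall>k\<in>{1..<r}. A k * X k * B k - C k * X (k + 1) * D k = E k) \<and>
     A r * X r * B r - C r * X 1 * D r = E r"

text \<open>The unknowns range over the extensional function space, so that uniqueness refers only to
  \<open>X 1, \<dots>, X r\<close>.\<close>

definition sylvester_nonsingular ::
  "nat \<Rightarrow> nat \<Rightarrow> (nat \<Rightarrow> complex mat) \<Rightarrow> (nat \<Rightarrow> complex mat) \<Rightarrow> (nat \<Rightarrow> complex mat) \<Rightarrow> (nat \<Rightarrow> complex mat)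
    \<Rightarrow> bool" where
  "sylvester_nonsingular n r A B C D \<longleftrightarrow>
     (\<forall>E \<in> {1..r} \<rightarrow> carrier_mat n n.
        \<exists>!X. X \<in> {1..r} \<rightarrow>\<^sub>E carrier_mat n n \<and> sylvester_solution r A B C D E X)"

definition unitary_mat :: "nat \<Rightarrow> complex mat \<Rightarrow> bool" where
  "unitary_mat n U \<longleftrightarrow>
     U \<in> carrier_mat n n \<and> mat_adjoint U * U = 1\<^sub>m n \<and> U * mat_adjoint U = 1\<^sub>m n"

definition periodic_schur ::
  "nat \<Rightarrow> nat \<Rightarrow> (nat \<Rightarrow> complex mat) \<Rightarrow> (nat \<Rightarrow> complex mat) \<Rightarrow> (nat \<Rightarrow> complex mat) \<Rightarrow> (nat \<Rightarrow> complex mat)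
    \<Rightarrow> (nat \<Rightarrow> complex mat) \<Rightarrow> (nat \<Rightarrow> complex mat) \<Rightarrow> bool" where
  "periodic_schur n p M N Q Z T R \<longleftrightarrow>
     Z (p + 1) = Z 1 \<and>
     (\<forall>k\<in>{1..p}. unitary_mat n (Q k) \<and> unitary_mat n (Z k) \<and>
        mat_adjoint (Q k) * M k * Z k = T k \<and> upper_triangular (T k) \<and>
        mat_adjoint (Q k) * N k * Z (k + 1) = R k \<and> upper_triangular (R k))"

text \<open>The formal product \<open>N\<^sub>p\<^sup>-\<^sup>1 M\<^sub>p \<cdots> N\<^sub>1\<^sup>-\<^sup>1 M\<^sub>1\<close> is represented by the families \<open>M\<close> and \<open>N\<close>, and so is
  the cyclically shifted one \<open>M\<^sub>p N\<^bsub>p-1\<^esub>\<^sup>-\<^sup>1 \<cdots> N\<^sub>1\<^sup>-\<^sup>1 M\<^sub>1 N\<^sub>p\<^sup>-\<^sup>1\<close>, whose regularity and spectrum are given by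
  the same formulas. A decomposition exists for all \<open>M\<close> and \<open>N\<close>, and neither singularity nor the
  spectrum of a regular product depends on its choice; hence the existential quantifiers below.\<close>

definition formal_singular ::
  "nat \<Rightarrow> nat \<Rightarrow> (nat \<Rightarrow> complex mat) \<Rightarrow> (nat \<Rightarrow> complex mat) \<Rightarrow> bool" where
  "formal_singular n p M N \<longleftrightarrow>
     (\<exists>Q Z T R. periodic_schur n p M N Q Z T R \<and>
        (\<exists>i<n. (\<Prod>k=1..p. T k $$ (i, i)) = 0 \<and> (\<Prod>k=1..p. R k $$ (i, i)) = 0))"

definition formal_regular ::
  "nat \<Rightarrow> nat \<Rightarrow> (nat \<Rightarrow> complex mat) \<Rightarrow> (nat \<Rightarrow> complex mat) \<Rightarrow> bool" where
  "formal_regular n p M N \<longleftrightarrow> \<not> formal_singular n p M N"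

text \<open>The set \<open>\<complex> \<union> {\<infinity>}\<close> is the type \<open>complex option\<close>, with \<open>None\<close> as the point at infinity. The
  value at \<open>a = b = 0\<close> is irrelevant: it does not occur for regular products.\<close>

definition ext_quotient :: "complex \<Rightarrow> complex \<Rightarrow> complex option" where
  "ext_quotient a b = (if b = 0 then None else Some (a / b))"

definition formal_spectrum ::
  "nat \<Rightarrow> nat \<Rightarrow> (nat \<Rightarrow> complex mat) \<Rightarrow> (nat \<Rightarrow> complex mat) \<Rightarrow> complex option set" where
  "formal_spectrum n p M N =
     {ext_quotient (\<Prod>k=1..p. T k $$ (i, i)) (\<Prod>k=1..p. R k $$ (i, i)) | Q Z T R i.
        periodic_schur n p M N Q Z T R \<and> i < n}"

end

theory Submission
  imports Defs "Jordan_Normal_Form.Spectral_Radius"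
begin

text \<open>Put both pairs of matrix families into periodic Schur form. The substitution
  \<open>Y\<^sub>k = Z\<^sub>k\<^sup>H X\<^sub>k Q'\<^bsub>k-1\<^esub>\<close>, with \<open>Q, Z\<close> from the decomposition of \<open>(A, C)\<close> and \<open>Q'\<close> from that of
  \<open>(D, B')\<close>, turns the system into one of the same shape in which all coefficients are upper
  triangular (\<open>sylvester_nonsingular_transform\<close>). There the equation at position \<open>(i, j)\<close> involves
  only entries \<open>(a, b)\<close> of the unknowns with \<open>a \<ge> i\<close> and \<open>b \<le> j\<close>, so that the system is block
  triangular, and its diagonal block at \<open>(i, j)\<close> is the scalar cyclic system
  \<open>a\<^sub>k x\<^sub>k - c\<^sub>k x\<^bsub>k+1\<^esub> = e\<^sub>k\<close> with \<open>a\<^sub>k = (T\<^sub>k)\<^sub>i\<^sub>i (R'\<^bsub>k-1\<^esub>)\<^sub>j\<^sub>j\<close> and \<open>c\<^sub>k = (R\<^sub>k)\<^sub>i\<^sub>i (T'\<^sub>k)\<^sub>j\<^sub>j\<close>. Such a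
  scalar system is nonsingular if and only if \<open>\<Prod>a\<^sub>k \<noteq> \<Prod>c\<^sub>k\<close>. Hence, for any choice of the two
  decompositions, the matrix system is nonsingular if and only if
  \<open>\<Prod>(T\<^sub>k)\<^sub>i\<^sub>i \<Prod>(R'\<^sub>k)\<^sub>j\<^sub>j \<noteq> \<Prod>(R\<^sub>k)\<^sub>i\<^sub>i \<Prod>(T'\<^sub>k)\<^sub>j\<^sub>j\<close> for all \<open>i, j\<close> (\<open>sylvester_nonsingular_iff_diagonals\<close>).

  This is a cross-multiplied form of the claim. If \<open>\<Prod>(T\<^sub>k)\<^sub>i\<^sub>i = \<Prod>(R\<^sub>k)\<^sub>i\<^sub>i = 0\<close> for some \<open>i\<close>, both sides
  vanish for every \<open>j\<close>, and at least one \<open>j\<close> exists; a singular second product has the same effect.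
  If both products are regular, equality of the two sides says \<open>\<lambda>\<^sub>i = \<mu>\<^sub>j\<close> in \<open>\<complex> \<union> {\<infinity>}\<close>. The criterion holds for every pair of decompositions, which gives
  regularity and disjointness for all of them at once when the system is nonsingular. Conversely,
  regularity and disjointness say something about the system only because a decomposition of each
  pair exists (\<open>periodic_schur_exists\<close>).

  Existence follows by deflation from nonzero vectors \<open>z\<^sub>1, \<dots>, z\<^sub>p\<close> such that \<open>M\<^sub>k z\<^sub>k\<close> and
  \<open>N\<^sub>k z\<^bsub>k+1\<^esub>\<close> lie on a common line for every \<open>k\<close>, cyclically (\<open>cyclic_common_lines\<close>). If all \<open>M\<^sub>k\<close> and
  \<open>N\<^sub>k\<close> are invertible, an eigenvector of the product generates them. If some \<open>N\<^sub>q\<close> is singular,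
  choosing \<open>z\<^bsub>q+1\<^esub>\<close> in its kernel satisfies the condition at \<open>q\<close> whatever \<open>z\<^sub>q\<close> is, and the other
  vectors are found by going forward around the cycle; if some \<open>M\<^sub>q\<close> is singular, going backward
  from its kernel works in the same way.\<close>

section \<open>Square linear systems over a finite index set\<close>

text \<open>Linear systems are handled through coefficient functions \<open>K\<close> on an arbitrary finite index set
  \<open>S\<close>, not through matrices: the unknowns here carry triple indices, and diagonal blocks are then
  just subsets of \<open>S\<close>.\<close>
definition trivial_kernel :: "('s \<Rightarrow> 's \<Rightarrow> 'a::field) \<Rightarrow> 's set \<Rightarrow> bool" where
  "trivial_kernel K S \<longleftrightarrow>
     (\<forall>y. (\<forall>s\<in>S. (\<Sum>t\<in>S. K s t * y t) = 0) \<longrightarrow> (\<forall>s\<in>S. y s = 0))"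

lemma trivial_kernelI:
  assumes "\<And>y s. (\<And>s. s \<in> S \<Longrightarrow> (\<Sum>t\<in>S. K s t * y t) = 0) \<Longrightarrow> s \<in> S \<Longrightarrow> y s = 0"
  shows "trivial_kernel K S"
  using assms unfolding trivial_kernel_def by blast

lemma trivial_kernelD:
  assumes "trivial_kernel K S" "\<And>s. s \<in> S \<Longrightarrow> (\<Sum>t\<in>S. K s t * y t) = 0" "s \<in> S"
  shows "y s = 0"
  using assms unfolding trivial_kernel_def by blast

lemma trivial_kernel_cong:
  assumes "\<And>s t. s \<in> S \<Longrightarrow> t \<in> S \<Longrightarrow> K s t = L s t"
  shows "trivial_kernel K S \<longleftrightarrow> trivial_kernel L S"
  using assms unfolding trivial_kernel_def by simp

lemma trivial_kernel_reindex:
  assumes h: "bij_betw h I S"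
  shows "trivial_kernel K S \<longleftrightarrow> trivial_kernel (\<lambda>i j. K (h i) (h j)) I"
proof -
  have inj: "inj_on h I" and im: "h ` I = S"
    using h by (auto simp: bij_betw_def)
  have s: "(\<Sum>t\<in>S. K u t * y t) = (\<Sum>j\<in>I. K u (h j) * y (h j))" for u y
    using sum.reindex_bij_betw[OF h, of "\<lambda>t. K u t * y t"] by simp
  show ?thesis
  proof
    assume k: "trivial_kernel K S"
    show "trivial_kernel (\<lambda>i j. K (h i) (h j)) I"
    proof (rule trivial_kernelI)
      fix y i
      assume y: "\<And>i. i \<in> I \<Longrightarrow> (\<Sum>j\<in>I. K (h i) (h j) * y j) = 0" and i: "i \<in> I"
      define z where "z t = y (the_inv_into I h t)" for t
      have z: "z (h j) = y j" if "j \<in> I" for j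
        using that by (simp add: z_def the_inv_into_f_f[OF inj])
      have "(\<Sum>t\<in>S. K u t * z t) = 0" if "u \<in> S" for u
        using y that im unfolding s by (auto simp: z)
      from trivial_kernelD[OF k this, of "h i"] i im z[OF i] show "y i = 0" by auto
    qed
  next
    assume k: "trivial_kernel (\<lambda>i j. K (h i) (h j)) I"
    show "trivial_kernel K S"
    proof (rule trivial_kernelI)
      fix y u
      assume y: "\<And>u. u \<in> S \<Longrightarrow> (\<Sum>t\<in>S. K u t * y t) = 0" and u: "u \<in> S"
      from u im obtain i where i: "i \<in> I" "u = h i" by auto
      have "(\<Sum>j\<in>I. K (h i) (h j) * y (h j)) = 0" if "i \<in> I" for i
        using y[of "h i"] that im unfolding s by auto
      from trivial_kernelD[OF k this i(1)] i(2) show "y u = 0" by simp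
    qed
  qed
qed

lemma trivial_kernel_iff_det:
  "trivial_kernel (\<lambda>i j. M $$ (i, j)) {0..<n} \<longleftrightarrow> det M \<noteq> 0"
  if M: "(M :: 'a::field mat) \<in> carrier_mat n n"
proof -
  have idx: "(M *\<^sub>v v) $ i = (\<Sum>j=0..<n. M $$ (i, j) * v $ j)"
    if "v \<in> carrier_vec n" "i < n" for v i
    using M that by (auto simp: scalar_prod_def intro!: sum.cong)
  show ?thesis
  proof
    assume k: "trivial_kernel (\<lambda>i j. M $$ (i, j)) {0..<n}"
    show "det M \<noteq> 0"
    proof
      assume "det M = 0"
      then obtain v where v: "v \<in> carrier_vec n" "v \<noteq> 0\<^sub>v n" "M *\<^sub>v v = 0\<^sub>v n"
        using det_0_iff_vec_prod_zero_field[OF M] by auto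
      have "v $ i = 0" if "i < n" for i
        by (rule trivial_kernelD[OF k]) (use idx[OF v(1)] v(3) that in auto)
      with v(1,2) show False by (auto intro: eq_vecI)
    qed
  next
    assume d: "det M \<noteq> 0"
    show "trivial_kernel (\<lambda>i j. M $$ (i, j)) {0..<n}"
    proof (rule trivial_kernelI)
      fix y i
      assume y: "\<And>i. i \<in> {0..<n} \<Longrightarrow> (\<Sum>j=0..<n. M $$ (i, j) * y j) = 0" and i: "i \<in> {0..<n}"
      have "M *\<^sub>v vec n y = 0\<^sub>v n"
        by (rule eq_vecI) (use idx[of "vec n y"] y M in auto)
      hence "vec n y = 0\<^sub>v n"
        using d det_0_iff_vec_prod_zero_field[OF M] by (metis vec_carrier)
      thus "y i = 0" using i by (metis atLeastLessThan_iff index_vec index_zero_vec(1))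
    qed
  qed
qed

text \<open>The Fredholm alternative: after numbering \<open>S\<close>, both sides say that the coefficient matrix has
  nonzero determinant.\<close>
lemma trivial_kernel_iff_solvable:
  fixes K :: "'s \<Rightarrow> 's \<Rightarrow> 'a::field"
  assumes "finite S"
  shows "trivial_kernel K S \<longleftrightarrow> (\<forall>e. \<exists>y. \<forall>s\<in>S. (\<Sum>t\<in>S. K s t * y t) = e s)"
proof -
  define m where "m = card S"
  obtain h where h: "bij_betw h {0..<m} S"
    using ex_bij_betw_nat_finite[OF assms] m_def by auto
  have inj: "inj_on h {0..<m}" and im: "h ` {0..<m} = S"
    using h by (auto simp: bij_betw_def)
  define g where "g = the_inv_into {0..<m} h"
  have gh: "g (h i) = i" if "i < m" for i
    using that by (simp add: g_def the_inv_into_f_f[OF inj])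
  have s: "(\<Sum>t\<in>S. K u t * y t) = (\<Sum>j=0..<m. K u (h j) * y (h j))" for u y
    using sum.reindex_bij_betw[OF h, of "\<lambda>t. K u t * y t"] by simp
  define M where "M = mat m m (\<lambda>(i, j). K (h i) (h j))"
  have M: "M \<in> carrier_mat m m" by (simp add: M_def)
  have "trivial_kernel K S \<longleftrightarrow> trivial_kernel (\<lambda>i j. M $$ (i, j)) {0..<m}"
    unfolding trivial_kernel_reindex[OF h] by (rule trivial_kernel_cong) (auto simp: M_def)
  also have "\<dots> \<longleftrightarrow> det M \<noteq> 0" by (rule trivial_kernel_iff_det[OF M])
  also have "\<dots> \<longleftrightarrow> (\<forall>e. \<exists>y. \<forall>s\<in>S. (\<Sum>t\<in>S. K s t * y t) = e s)"
  proof
    assume "det M \<noteq> 0"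
    then obtain B where B: "B \<in> carrier_mat m m" "M * B = 1\<^sub>m m"
      using det_non_zero_imp_unit[OF M, of "()"] unfolding Units_def ring_mat_def by auto
    show "\<forall>e. \<exists>y. \<forall>s\<in>S. (\<Sum>t\<in>S. K s t * y t) = e s"
    proof
      fix e :: "'s \<Rightarrow> 'a"
      define w where "w = B *\<^sub>v vec m (\<lambda>i. e (h i))"
      have w: "w \<in> carrier_vec m" using B by (simp add: w_def)
      have Mw: "M *\<^sub>v w = vec m (\<lambda>i. e (h i))"
        unfolding w_def using B M by (simp flip: assoc_mult_mat_vec)
      have "(\<Sum>t\<in>S. K u t * w $ g t) = e u" if u: "u \<in> S" for u
      proof -
        from u im obtain i where i: "i < m" "u = h i" by auto
        have "(\<Sum>t\<in>S. K u t * w $ g t) = (M *\<^sub>v w) $ i"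
          unfolding s using i w M
          by (auto simp: M_def scalar_prod_def gh intro!: sum.cong)
        thus ?thesis using i unfolding Mw by simp
      qed
      thus "\<exists>y. \<forall>s\<in>S. (\<Sum>t\<in>S. K s t * y t) = e s"
        by (intro exI[of _ "\<lambda>t. w $ g t"]) blast
    qed
  next
    assume *: "\<forall>e. \<exists>y. \<forall>s\<in>S. (\<Sum>t\<in>S. K s t * y t) = e s"
    have "\<exists>y. \<forall>s\<in>S. (\<Sum>t\<in>S. K s t * y t) = (if s = h k then 1 else 0)" for k
      by (rule *[rule_format, of "\<lambda>s. if s = h k then 1 else 0"])
    then obtain Y where Y: "\<And>k s. s \<in> S \<Longrightarrow>
        (\<Sum>t\<in>S. K s t * Y k t) = (if s = h k then 1 else 0)"
      by metis
    define B where "B = mat m m (\<lambda>(i, k). Y k (h i))"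
    have B: "B \<in> carrier_mat m m" by (simp add: B_def)
    have "M * B = 1\<^sub>m m"
    proof (rule eq_matI)
      fix i k assume "i < dim_row (1\<^sub>m m)" "k < dim_col (1\<^sub>m m)"
      hence ik: "i < m" "k < m" by auto
      have "(M * B) $$ (i, k) = (\<Sum>t\<in>S. K (h i) t * Y k t)"
        unfolding s using ik by (auto simp: M_def B_def scalar_prod_def intro!: sum.cong)
      also have "\<dots> = (if h i = h k then 1 else 0)"
        using ik im by (intro Y) auto
      also have "\<dots> = 1\<^sub>m m $$ (i, k)"
        using ik gh by (auto, metis)
      finally show "(M * B) $$ (i, k) = 1\<^sub>m m $$ (i, k)" .
    qed (auto simp: M_def B_def)
    from det_mult[OF M B] this show "det M \<noteq> 0" by auto
  qed
  finally show ?thesis .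
qed

text \<open>Equations of a given rank involve only unknowns of the same or a higher rank. If all diagonal
  blocks are injective, a kernel vector vanishes by descending induction on the rank. Conversely,
  vectors supported on ranks at most \<open>m\<close> form an invariant subspace, so injectivity passes to it; there
  the equations of rank \<open>m\<close> involve only the block \<open>m\<close>, so that solvability passes on to the block. This
  is why the proof switches from kernels to solvability and back.\<close>
lemma trivial_kernel_block_triangular:
  fixes rank :: "'s \<Rightarrow> nat"
  assumes fin: "finite S"
    and tri: "\<And>s t. s \<in> S \<Longrightarrow> t \<in> S \<Longrightarrow> rank t < rank s \<Longrightarrow> K s t = 0"
  shows "trivial_kernel K S \<longleftrightarrow> (\<forall>m. trivial_kernel K {s \<in> S. rank s = m})"
proof
  assume k: "trivial_kernel K S"
  show "\<forall>m. trivial_kernel K {s \<in> S. rank s = m}"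
  proof
    fix m
    let ?L = "{s \<in> S. rank s \<le> m}" and ?E = "{s \<in> S. rank s = m}"
    have "trivial_kernel K ?L"
    proof (rule trivial_kernelI)
      fix y s assume y: "\<And>s. s \<in> ?L \<Longrightarrow> (\<Sum>t\<in>?L. K s t * y t) = 0" and s: "s \<in> ?L"
      define z where "z t = (if rank t \<le> m then y t else 0)" for t
      have "(\<Sum>t\<in>S. K u t * z t) = 0" if u: "u \<in> S" for u
      proof -
        have "(\<Sum>t\<in>S. K u t * z t) = (\<Sum>t\<in>?L. K u t * y t)"
          by (rule sum.mono_neutral_cong_right[OF fin]) (auto simp: z_def)
        also have "\<dots> = 0"
        proof (cases "rank u \<le> m")
          case True thus ?thesis using y u by simp
        next
          case False thus ?thesis using u by (intro sum.neutral) (auto simp: tri)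
        qed
        finally show ?thesis .
      qed
      from trivial_kernelD[OF k this, of s] s show "y s = 0" by (simp add: z_def)
    qed
    hence sol: "\<exists>y. \<forall>s\<in>?L. (\<Sum>t\<in>?L. K s t * y t) = e s" for e
      using trivial_kernel_iff_solvable[of ?L K] fin by auto
    have "\<exists>y. \<forall>s\<in>?E. (\<Sum>t\<in>?E. K s t * y t) = e s" for e
    proof -
      obtain y where y: "\<And>s. s \<in> ?L \<Longrightarrow> (\<Sum>t\<in>?L. K s t * y t) = e s" using sol[of e] by blast
      have "(\<Sum>t\<in>?E. K s t * y t) = e s" if "s \<in> ?E" for s
      proof -
        have "(\<Sum>t\<in>?L. K s t * y t) = (\<Sum>t\<in>?E. K s t * y t)"
        proof (rule sum.mono_neutral_right)
          show "\<forall>t\<in>?L - ?E. K s t * y t = 0" using tri that by force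
        qed (use fin in auto)
        with y[of s] that show ?thesis by simp
      qed
      thus ?thesis by blast
    qed
    thus "trivial_kernel K ?E" using trivial_kernel_iff_solvable[of ?E K] fin by auto
  qed
next
  assume k: "\<forall>m. trivial_kernel K {s \<in> S. rank s = m}"
  show "trivial_kernel K S"
  proof (rule trivial_kernelI)
    fix y s assume y: "\<And>s. s \<in> S \<Longrightarrow> (\<Sum>t\<in>S. K s t * y t) = 0" and s: "s \<in> S"
    define N where "N = Max (rank ` S)"
    have N: "rank t \<le> N" if "t \<in> S" for t using that fin by (simp add: N_def)
    from s show "y s = 0"
    proof (induction "N - rank s" arbitrary: s rule: less_induct)
      case less
      let ?E = "{t \<in> S. rank t = rank s}"
      have "(\<Sum>t\<in>?E. K u t * y t) = 0" if u: "u \<in> ?E" for u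
      proof -
        have "(\<Sum>t\<in>S. K u t * y t) = (\<Sum>t\<in>?E. K u t * y t)"
        proof (rule sum.mono_neutral_right[OF fin])
          show "\<forall>t\<in>S - ?E. K u t * y t = 0"
          proof
            fix t assume t: "t \<in> S - ?E"
            show "K u t * y t = 0"
            proof (cases "rank t < rank u")
              case True thus ?thesis using tri t u by simp
            next
              case False
              with t u N[of t] have "N - rank t < N - rank s" by auto
              from less(1)[OF this] t show ?thesis by simp
            qed
          qed
        qed auto
        thus ?thesis using y[of u] u by simp
      qed
      from trivial_kernelD[OF k[rule_format] this, of s] less(2) show ?case by auto
    qed
  qed
qed

section \<open>Scalar cyclic systems\<close>
definition cyc_succ :: "nat \<Rightarrow> nat \<Rightarrow> nat" where
  "cyc_succ r k = (if k = r then 1 else k + 1)"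

definition cyc_pred :: "nat \<Rightarrow> nat \<Rightarrow> nat" where
  "cyc_pred r k = (if k = 1 then r else k - 1)"

lemma cyc_range: "k \<in> {1..r} \<Longrightarrow> cyc_succ r k \<in> {1..r}" "k \<in> {1..r} \<Longrightarrow> cyc_pred r k \<in> {1..r}"
  by (auto simp: cyc_succ_def cyc_pred_def)

lemma cyc_inverse [simp]:
  "k \<in> {1..r} \<Longrightarrow> cyc_pred r (cyc_succ r k) = k" "k \<in> {1..r} \<Longrightarrow> cyc_succ r (cyc_pred r k) = k"
  by (auto simp: cyc_succ_def cyc_pred_def)

lemma prod_cyc_pred:
  "(\<Prod>k=1..r. f (cyc_pred r k)) = (\<Prod>k=1..r. f k)"
  by (rule prod.reindex_bij_witness[of _ "cyc_succ r" "cyc_pred r"])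
    (use cyc_range cyc_inverse in auto)

text \<open>Following the equations once around the cycle gives \<open>(\<Prod>a\<^sub>k) x\<^sub>1 = (\<Prod>c\<^sub>k) x\<^sub>1\<close>, so \<open>x\<^sub>1 = 0\<close>. One of
  the products is nonzero; if it is \<open>\<Prod>c\<^sub>k\<close>, zeros propagate upwards from \<open>x\<^sub>1\<close>, otherwise downwards
  from \<open>x\<^bsub>r+1\<^esub> = x\<^sub>1\<close>.\<close>
lemma cyclic_scalar_kernel_trivial:
  fixes a c x :: "nat \<Rightarrow> 'a::field"
  assumes ne: "(\<Prod>k=1..r. a k) \<noteq> (\<Prod>k=1..r. c k)"
    and eq: "\<And>k. k \<in> {1..r} \<Longrightarrow> a k * x k = c k * x (cyc_succ r k)"
    and k: "k \<in> {1..r}"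
  shows "x k = 0"
proof -
  \<comment> \<open>The cycle is cut open at \<open>1\<close>: \<open>z\<close> lives on \<open>1, \<dots>, r + 1\<close> and has equal end values.\<close>
  define z where "z m = x (if m = Suc r then 1 else m)" for m
  have eqz: "a m * z m = c m * z (Suc m)" if "1 \<le> m" "m \<le> r" for m
    using eq[of m] that by (auto simp: z_def cyc_succ_def)
  have tel: "(\<Prod>i=1..m. a i) * z 1 = (\<Prod>i=1..m. c i) * z (Suc m)" if "m \<le> r" for m
    using that
  proof (induction m)
    case (Suc m)
    have "(\<Prod>i=1..Suc m. a i) * z 1 = a (Suc m) * ((\<Prod>i=1..m. a i) * z 1)"
      by (simp add: mult_ac)
    also have "\<dots> = (\<Prod>i=1..m. c i) * (a (Suc m) * z (Suc m))"
      using Suc by (simp add: mult_ac)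
    also have "\<dots> = (\<Prod>i=1..Suc m. c i) * z (Suc (Suc m))"
      using Suc eqz[of "Suc m"] by (simp add: mult_ac)
    finally show ?case .
  qed simp
  have r: "1 \<le> r" using k by simp
  have "z 1 = 0" "z (Suc r) = 0"
    using tel[of r] ne r by (auto simp: z_def)
  have zk: "z k = 0"
  proof (cases "(\<Prod>k=1..r. c k) = 0")
    case True
    hence "(\<Prod>k=1..r. a k) \<noteq> 0" using ne by metis
    hence "a m \<noteq> 0" if "m \<in> {1..r}" for m using that by auto
    hence down: "z (Suc m) = 0 \<Longrightarrow> z m = 0" if "1 \<le> m" "m \<le> r" for m
      using eqz[OF that] that by auto
    have "k \<le> Suc r" using k by simp
    then show ?thesis using k
    proof (induction rule: inc_induct)
      case (step m) thus ?case using down[of m] \<open>z (Suc r) = 0\<close> by (cases "m = r") auto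
    qed (use \<open>z (Suc r) = 0\<close> in auto)
  next
    case False
    hence "c m \<noteq> 0" if "m \<in> {1..r}" for m using that by auto
    hence up: "z m = 0 \<Longrightarrow> z (Suc m) = 0" if "1 \<le> m" "m \<le> r" for m
      using eqz[OF that] that by auto
    have "1 \<le> k" using k by simp
    then show ?thesis using k
    proof (induction rule: dec_induct)
      case (step m) thus ?case using up[of m] by auto
    qed (use \<open>z 1 = 0\<close> in auto)
  qed
  thus ?thesis using k by (auto simp: z_def)
qed

text \<open>If the products agree and are nonzero, \<open>x\<^sub>k = a\<^sub>1 \<cdots> a\<^bsub>k-1\<^esub> c\<^sub>k \<cdots> c\<^sub>r\<close> is a kernel vector that closes up.
  If both vanish, this formula can give zero. Then let \<open>c\<^sub>q = 0\<close> and let \<open>p\<close> be the first index after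
  \<open>q\<close>, in cyclic order, with \<open>a\<^sub>p = 0\<close>; the same formula on the arc from \<open>q + 1\<close> to \<open>p\<close>, extended by
  zero, satisfies every equation because \<open>c\<^sub>q\<close> and \<open>a\<^sub>p\<close> decouple the arc from its complement, and its
  value at \<open>p\<close> is a product of nonzero \<open>a\<close>'s.\<close>
lemma cyclic_scalar_kernel_nontrivial:
  fixes a c :: "nat \<Rightarrow> 'a::field"
  assumes eq: "(\<Prod>k=1..r. a k) = (\<Prod>k=1..r. c k)" and r: "1 \<le> r"
  shows "\<exists>x. (\<forall>k\<in>{1..r}. a k * x k = c k * x (cyc_succ r k)) \<and> (\<exists>k\<in>{1..r}. x k \<noteq> 0)"
proof (cases "(\<Prod>k=1..r. c k) = 0")
  case False
  define x where "x k = (\<Prod>i=1..<k. a i) * (\<Prod>i=k..r. c i)" for k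
  have "a k * x k = c k * x (cyc_succ r k)" if k: "k \<in> {1..r}" for k
  proof -
    have "a k * x k = (\<Prod>i=1..<Suc k. a i) * (\<Prod>i=k..r. c i)"
      using k by (simp add: x_def mult_ac)
    also have "(\<Prod>i=k..r. c i) = c k * (\<Prod>i=Suc k..r. c i)"
      using k by (intro prod.atLeast_Suc_atMost) auto
    finally have *: "a k * x k = c k * x (Suc k)" by (simp add: x_def mult_ac)
    show ?thesis
    proof (cases "k = r")
      case True
      have "x (Suc r) = x 1" using eq by (simp add: x_def atLeastLessThanSuc_atLeastAtMost)
      with * True show ?thesis by (simp add: cyc_succ_def)
    qed (use * in \<open>simp add: cyc_succ_def\<close>)
  qed
  moreover have "x 1 \<noteq> 0" using False by (simp add: x_def)
  moreover have "1 \<in> {1..r}" using r by simp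
  ultimately show ?thesis by (intro exI[of _ x]) blast
next
  case True
  then obtain q where q: "q \<in> {1..r}" "c q = 0" by auto
  from True eq have "(\<Prod>k=1..r. a k) = 0" by metis
  then obtain p0 where p0: "p0 \<in> {1..r}" "a p0 = 0" by auto
  \<comment> \<open>Unroll the cycle: the indices \<open>q + 1, \<dots>, q + r\<close> represent each class once, and the arc
    becomes an interval.\<close>
  define a' where "a' m = a (if m \<le> r then m else m - r)" for m
  define c' where "c' m = c (if m \<le> r then m else m - r)" for m
  define p where "p = (LEAST m. q < m \<and> a' m = 0)"
  have "q < p \<and> a' p = 0"
    unfolding p_def
    by (rule LeastI[of _ "if q < p0 then p0 else p0 + r"]) (use p0 q in \<open>auto simp: a'_def\<close>)
  hence p: "q < p" "a' p = 0" by auto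
  have "p \<le> q + r"
    unfolding p_def
    by (rule order_trans[OF Least_le[of _ "if q < p0 then p0 else p0 + r"]])
      (use p0 q in \<open>auto simp: a'_def\<close>)
  have min: "a' m \<noteq> 0" if "q < m" "m < p" for m
    using not_less_Least[of m "\<lambda>m. q < m \<and> a' m = 0"] that by (auto simp: p_def)
  define y where "y m = (if m \<le> p then (\<Prod>i\<in>{q<..<m}. a' i) * (\<Prod>i=m..<p. c' i) else 0)" for m
  define rep where "rep k = (if q < k then k else k + r)" for k
  have step: "a' m * y m = c' m * y (Suc m)" if "q < m" for m
  proof (cases "m < p")
    case True
    have "{q<..<Suc m} = insert m {q<..<m}" using that by auto
    moreover have "{m..<p} = insert m {Suc m..<p}" using True by auto
    ultimately show ?thesis using True by (simp add: y_def mult_ac)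
  next
    case False
    thus ?thesis using p by (cases "m = p") (auto simp: y_def)
  qed
  have "a k * y (rep k) = c k * y (rep (cyc_succ r k))" if k: "k \<in> {1..r}" for k
  proof (cases "k = q")
    case True
    have "a q * y (q + r) = 0"
    proof (cases "p = q + r")
      case True
      thus ?thesis using p q by (simp add: a'_def)
    next
      case False
      with \<open>p \<le> q + r\<close> show ?thesis by (simp add: y_def)
    qed
    thus ?thesis using True q by (simp add: rep_def)
  next
    case False
    have "rep (cyc_succ r k) = Suc (rep k)"
      using False k q by (auto simp: rep_def cyc_succ_def)
    moreover have "a' (rep k) = a k" "c' (rep k) = c k" "q < rep k"
      using k q by (auto simp: rep_def a'_def c'_def)
    ultimately show ?thesis using step[of "rep k"] by simp
  qed
  moreover have "\<exists>k\<in>{1..r}. y (rep k) \<noteq> 0"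
  proof -
    have "y p \<noteq> 0" using min by (simp add: y_def)
    moreover have "p = rep (if p \<le> r then p else p - r)"
      using p q \<open>p \<le> q + r\<close> by (auto simp: rep_def)
    moreover have "(if p \<le> r then p else p - r) \<in> {1..r}"
      using p q \<open>p \<le> q + r\<close> by auto
    ultimately show ?thesis by metis
  qed
  ultimately show ?thesis by (intro exI[of _ "\<lambda>k. y (rep k)"]) auto
qed

lemma cyclic_scalar_trivial_kernel_iff:
  fixes a c :: "nat \<Rightarrow> 'a::field"
  assumes r: "1 \<le> r"
  shows "trivial_kernel (\<lambda>k l. (if l = k then a k else 0) - (if l = cyc_succ r k then c k else 0))
      {1..r} \<longleftrightarrow> (\<Prod>k=1..r. a k) \<noteq> (\<Prod>k=1..r. c k)"
proof -
  have row: "(\<Sum>l=1..r. ((if l = k then a k else 0) - (if l = cyc_succ r k then c k else 0)) * x l)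
      = a k * x k - c k * x (cyc_succ r k)" if "k \<in> {1..r}" for k x
  proof -
    have "(\<Sum>l=1..r. ((if l = k then a k else 0) - (if l = cyc_succ r k then c k else 0)) * x l)
        = (\<Sum>l=1..r. if l = k then a k * x l else 0)
          - (\<Sum>l=1..r. if l = cyc_succ r k then c k * x l else 0)"
      unfolding sum_subtractf[symmetric] by (rule sum.cong) (auto simp: left_diff_distrib)
    thus ?thesis using that cyc_range(1)[OF that] by simp
  qed
  show ?thesis
  proof
    assume k: "trivial_kernel (\<lambda>k l. (if l = k then a k else 0)
        - (if l = cyc_succ r k then c k else 0)) {1..r}"
    show "(\<Prod>k=1..r. a k) \<noteq> (\<Prod>k=1..r. c k)"
    proof
      assume "(\<Prod>k=1..r. a k) = (\<Prod>k=1..r. c k)"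
      from cyclic_scalar_kernel_nontrivial[OF this r] obtain x k0 where
        x: "\<forall>k\<in>{1..r}. a k * x k = c k * x (cyc_succ r k)" "k0 \<in> {1..r}" "x k0 \<noteq> 0"
        by blast
      have "x k0 = 0"
        by (rule trivial_kernelD[OF k _ x(2)]) (subst row, use x(1) in auto)
      with x(3) show False by simp
    qed
  next
    assume ne: "(\<Prod>k=1..r. a k) \<noteq> (\<Prod>k=1..r. c k)"
    show "trivial_kernel (\<lambda>k l. (if l = k then a k else 0)
        - (if l = cyc_succ r k then c k else 0)) {1..r}"
    proof (rule trivial_kernelI)
      fix x k
      assume "\<And>k. k \<in> {1..r} \<Longrightarrow>
        (\<Sum>l=1..r. ((if l = k then a k else 0) - (if l = cyc_succ r k then c k else 0)) * x l) = 0"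
        and k: "k \<in> {1..r}"
      hence "a k * x k = c k * x (cyc_succ r k)" if "k \<in> {1..r}" for k
        using row[OF that, of x] that by simp
      from cyclic_scalar_kernel_trivial[OF ne this k] show "x k = 0" .
    qed
  qed
qed

section \<open>The Sylvester system as a square linear system\<close>

text \<open>The unknown at index \<open>(l, a, b)\<close> is the entry \<open>(a, b)\<close> of \<open>X\<^sub>l\<close>. Both summands contribute to the
  same unknown when \<open>r = 1\<close>, hence the difference of two conditionals instead of a case
  distinction.\<close>
definition sylvester_coeff ::
  "nat \<Rightarrow> (nat \<Rightarrow> complex mat) \<Rightarrow> (nat \<Rightarrow> complex mat) \<Rightarrow> (nat \<Rightarrow> complex mat) \<Rightarrow> (nat \<Rightarrow> complex mat)
    \<Rightarrow> nat \<times> nat \<times> nat \<Rightarrow> nat \<times> nat \<times> nat \<Rightarrow> complex" where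
  "sylvester_coeff r A B C D = (\<lambda>(k, i, j) (l, a, b).
     (if l = k then A k $$ (i, a) * B k $$ (b, j) else 0)
     - (if l = cyc_succ r k then C k $$ (i, a) * D k $$ (b, j) else 0))"

definition family_entry :: "(nat \<Rightarrow> complex mat) \<Rightarrow> nat \<times> nat \<times> nat \<Rightarrow> complex" where
  "family_entry X = (\<lambda>(k, i, j). X k $$ (i, j))"

definition entry_set :: "nat \<Rightarrow> nat \<Rightarrow> (nat \<times> nat \<times> nat) set" where
  "entry_set n r = {1..r} \<times> {0..<n} \<times> {0..<n}"

lemma finite_entry_set [simp]: "finite (entry_set n r)"
  by (simp add: entry_set_def)

lemma index_triple_mult_mat:
  fixes A X B :: "'a::comm_semiring_1 mat"
  assumes "A \<in> carrier_mat n n" "X \<in> carrier_mat n n" "B \<in> carrier_mat n n" "i < n" "j < n"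
  shows "(A * X * B) $$ (i, j) = (\<Sum>a=0..<n. \<Sum>b=0..<n. A $$ (i, a) * B $$ (b, j) * X $$ (a, b))"
proof -
  have "(A * X * B) $$ (i, j) = row (A * X) i \<bullet> col B j"
    using assms by (intro index_mult_mat) auto
  also have "\<dots> = (\<Sum>b=0..<n. (\<Sum>a=0..<n. A $$ (i, a) * X $$ (a, b)) * B $$ (b, j))"
    using assms by (auto simp: scalar_prod_def intro!: sum.cong)
  also have "\<dots> = (\<Sum>b=0..<n. \<Sum>a=0..<n. A $$ (i, a) * B $$ (b, j) * X $$ (a, b))"
    by (intro sum.cong refl) (simp add: sum_distrib_left mult_ac)
  also have "\<dots> = (\<Sum>a=0..<n. \<Sum>b=0..<n. A $$ (i, a) * B $$ (b, j) * X $$ (a, b))"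
    by (rule sum.swap)
  finally show ?thesis .
qed

lemma sum_sylvester_coeff:
  assumes car: "\<And>k. k \<in> {1..r} \<Longrightarrow> A k \<in> carrier_mat n n" "\<And>k. k \<in> {1..r} \<Longrightarrow> B k \<in> carrier_mat n n"
    "\<And>k. k \<in> {1..r} \<Longrightarrow> C k \<in> carrier_mat n n" "\<And>k. k \<in> {1..r} \<Longrightarrow> D k \<in> carrier_mat n n"
    and X: "\<And>k. k \<in> {1..r} \<Longrightarrow> X k \<in> carrier_mat n n"
    and k: "k \<in> {1..r}" and ij: "i < n" "j < n"
  shows "(\<Sum>t\<in>entry_set n r. sylvester_coeff r A B C D (k, i, j) t * family_entry X t)
    = (A k * X k * B k - C k * X (cyc_succ r k) * D k) $$ (i, j)"
proof -
  note s = cyc_range(1)[OF k]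
  have "(\<Sum>t\<in>entry_set n r. sylvester_coeff r A B C D (k, i, j) t * family_entry X t)
    = (\<Sum>l=1..r. \<Sum>a=0..<n. \<Sum>b=0..<n.
        sylvester_coeff r A B C D (k, i, j) (l, a, b) * family_entry X (l, a, b))"
    unfolding entry_set_def by (simp add: sum.cartesian_product case_prod_unfold)
  also have "\<dots> = (\<Sum>l=1..r.
      (if l = k then \<Sum>a=0..<n. \<Sum>b=0..<n. A k $$ (i, a) * B k $$ (b, j) * X l $$ (a, b) else 0)
      - (if l = cyc_succ r k then
          \<Sum>a=0..<n. \<Sum>b=0..<n. C k $$ (i, a) * D k $$ (b, j) * X l $$ (a, b) else 0))"
    by (rule sum.cong)
      (auto simp: sylvester_coeff_def family_entry_def left_diff_distrib sum_subtractf)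
  also have "\<dots> = (\<Sum>a=0..<n. \<Sum>b=0..<n. A k $$ (i, a) * B k $$ (b, j) * X k $$ (a, b))
      - (\<Sum>a=0..<n. \<Sum>b=0..<n. C k $$ (i, a) * D k $$ (b, j) * X (cyc_succ r k) $$ (a, b))"
    using k s by (simp add: sum_subtractf)
  also have "\<dots> = (A k * X k * B k) $$ (i, j) - (C k * X (cyc_succ r k) * D k) $$ (i, j)"
    using car[OF k] X[OF k] X[OF s] ij by (simp only: index_triple_mult_mat[of _ n])
  also have "\<dots> = (A k * X k * B k - C k * X (cyc_succ r k) * D k) $$ (i, j)"
    using car[OF k] X[OF k] X[OF s] ij by simp
  finally show ?thesis .
qed

lemma sylvester_solution_cyc_succ:
  assumes "r \<ge> 1"
  shows "sylvester_solution r A B C D E X \<longleftrightarrow>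
    (\<forall>k\<in>{1..r}. A k * X k * B k - C k * X (cyc_succ r k) * D k = E k)"
proof -
  have "{1..r} = insert r {1..<r}" using assms by auto
  thus ?thesis by (auto simp: sylvester_solution_def cyc_succ_def)
qed

lemma sylvester_solution_iff_entries:
  assumes r: "r \<ge> 1"
    and car: "\<And>k. k \<in> {1..r} \<Longrightarrow> A k \<in> carrier_mat n n" "\<And>k. k \<in> {1..r} \<Longrightarrow> B k \<in> carrier_mat n n"
    "\<And>k. k \<in> {1..r} \<Longrightarrow> C k \<in> carrier_mat n n" "\<And>k. k \<in> {1..r} \<Longrightarrow> D k \<in> carrier_mat n n"
    and X: "\<And>k. k \<in> {1..r} \<Longrightarrow> X k \<in> carrier_mat n n"
    and E: "\<And>k. k \<in> {1..r} \<Longrightarrow> E k \<in> carrier_mat n n"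
  shows "sylvester_solution r A B C D E X \<longleftrightarrow>
    (\<forall>s\<in>entry_set n r. (\<Sum>t\<in>entry_set n r. sylvester_coeff r A B C D s t * family_entry X t)
       = family_entry E s)"
proof -
  have eq: "A k * X k * B k - C k * X (cyc_succ r k) * D k = E k \<longleftrightarrow>
    (\<forall>i<n. \<forall>j<n. (\<Sum>t\<in>entry_set n r. sylvester_coeff r A B C D (k, i, j) t * family_entry X t)
       = E k $$ (i, j))" if k: "k \<in> {1..r}" for k
  proof -
    have "A k * X k * B k - C k * X (cyc_succ r k) * D k \<in> carrier_mat n n"
      using car[OF k] X[OF k] X[OF cyc_range(1)[OF k]] by auto
    hence "A k * X k * B k - C k * X (cyc_succ r k) * D k = E k \<longleftrightarrow>
      (\<forall>i<n. \<forall>j<n. (A k * X k * B k - C k * X (cyc_succ r k) * D k) $$ (i, j) = E k $$ (i, j))"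
      using E[OF k] by (auto intro!: eq_matI)
    thus ?thesis using sum_sylvester_coeff[OF car X k] by simp
  qed
  show ?thesis
    unfolding sylvester_solution_cyc_succ[OF r]
    using eq by (auto simp: entry_set_def family_entry_def)
qed

lemma family_entry_mat:
  "s \<in> entry_set n r \<Longrightarrow> family_entry (\<lambda>k\<in>{1..r}. mat n n (\<lambda>(i, j). y (k, i, j))) s = y s"
  by (auto simp: family_entry_def entry_set_def)

lemma family_eqI:
  assumes "X \<in> {1..r} \<rightarrow>\<^sub>E carrier_mat n n" "Y \<in> {1..r} \<rightarrow>\<^sub>E carrier_mat n n"
    and "\<And>s. s \<in> entry_set n r \<Longrightarrow> family_entry X s = family_entry Y s"
  shows "X = Y"
proof (rule PiE_ext[OF assms(1,2)])
  fix k assume k: "k \<in> {1..r}"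
  have c: "X k \<in> carrier_mat n n" "Y k \<in> carrier_mat n n"
    using PiE_mem[OF assms(1) k] PiE_mem[OF assms(2) k] .
  have "X k $$ (i, j) = Y k $$ (i, j)" if "i < n" "j < n" for i j
    using assms(3)[of "(k, i, j)"] k that by (simp add: entry_set_def family_entry_def)
  thus "X k = Y k" using c by (intro eq_matI) auto
qed

lemma sylvester_nonsingular_iff_trivial_kernel:
  assumes r: "r \<ge> 1"
    and car: "\<And>k. k \<in> {1..r} \<Longrightarrow> A k \<in> carrier_mat n n" "\<And>k. k \<in> {1..r} \<Longrightarrow> B k \<in> carrier_mat n n"
    "\<And>k. k \<in> {1..r} \<Longrightarrow> C k \<in> carrier_mat n n" "\<And>k. k \<in> {1..r} \<Longrightarrow> D k \<in> carrier_mat n n"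
  shows "sylvester_nonsingular n r A B C D \<longleftrightarrow>
    trivial_kernel (sylvester_coeff r A B C D) (entry_set n r)"
proof -
  let ?S = "entry_set n r" and ?K = "sylvester_coeff r A B C D"
  let ?F = "\<lambda>y. \<lambda>k\<in>{1..r}. mat n n (\<lambda>(i, j). y (k, i, j))"
  have F: "?F y \<in> {1..r} \<rightarrow>\<^sub>E carrier_mat n n" for y by auto
  have Fsum: "(\<Sum>t\<in>?S. ?K s t * family_entry (?F y) t) = (\<Sum>t\<in>?S. ?K s t * y t)" for s y
    by (rule sum.cong[OF refl]) (simp only: family_entry_mat)
  have sol: "sylvester_solution r A B C D E X \<longleftrightarrow>
      (\<forall>s\<in>?S. (\<Sum>t\<in>?S. ?K s t * family_entry X t) = family_entry E s)"
    if "X \<in> {1..r} \<rightarrow>\<^sub>E carrier_mat n n" "E \<in> {1..r} \<rightarrow> carrier_mat n n" for X E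
    using that by (intro sylvester_solution_iff_entries r car) (auto simp: PiE_iff Pi_iff)
  have uniq: "X = Y" if "\<exists>!X. X \<in> S \<and> P X" "X \<in> S" "P X" "Y \<in> S" "P Y"
    for P S and X Y :: "nat \<Rightarrow> complex mat"
    using that by blast
  show ?thesis
  proof
    assume ns: "sylvester_nonsingular n r A B C D"
    show "trivial_kernel ?K ?S"
    proof (rule trivial_kernelI)
      fix y s assume y: "\<And>s. s \<in> ?S \<Longrightarrow> (\<Sum>t\<in>?S. ?K s t * y t) = 0" and s: "s \<in> ?S"
      let ?E = "?F (\<lambda>_. 0)"
      have E: "?E \<in> {1..r} \<rightarrow> carrier_mat n n" by auto
      have z: "family_entry ?E s = 0" if "s \<in> ?S" for s
        using family_entry_mat[OF that, of "\<lambda>_. 0"] by simp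
      have s1: "sylvester_solution r A B C D ?E (?F y)"
        unfolding sol[OF F[of y] E] Fsum using y z by auto
      have s2: "sylvester_solution r A B C D ?E ?E"
        unfolding sol[OF F[of "\<lambda>_. 0"] E] using z by auto
      have s0: "\<exists>!X. X \<in> {1..r} \<rightarrow>\<^sub>E carrier_mat n n \<and> sylvester_solution r A B C D ?E X"
        using ns E unfolding sylvester_nonsingular_def by (rule bspec)
      have "?F y = ?E" by (rule uniq[OF s0 F[of y] s1 F[of "\<lambda>_. 0"] s2])
      hence "family_entry (?F y) s = family_entry ?E s" by simp
      thus "y s = 0" unfolding family_entry_mat[OF s, of y] z[OF s] .
    qed
  next
    assume k: "trivial_kernel ?K ?S"
    show "sylvester_nonsingular n r A B C D"
      unfolding sylvester_nonsingular_def
    proof (intro ballI ex_ex1I)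
      fix E :: "nat \<Rightarrow> complex mat" assume E: "E \<in> {1..r} \<rightarrow> carrier_mat n n"
      obtain y where "\<forall>s\<in>?S. (\<Sum>t\<in>?S. ?K s t * y t) = family_entry E s"
        using k trivial_kernel_iff_solvable[OF finite_entry_set[of n r], of ?K] by blast
      hence "sylvester_solution r A B C D E (?F y)" unfolding sol[OF F E] Fsum .
      thus "\<exists>X. X \<in> {1..r} \<rightarrow>\<^sub>E carrier_mat n n \<and> sylvester_solution r A B C D E X"
        using F by blast
    next
      fix E X Y :: "nat \<Rightarrow> complex mat" assume E: "E \<in> {1..r} \<rightarrow> carrier_mat n n"
        and X: "X \<in> {1..r} \<rightarrow>\<^sub>E carrier_mat n n \<and> sylvester_solution r A B C D E X"
        and Y: "Y \<in> {1..r} \<rightarrow>\<^sub>E carrier_mat n n \<and> sylvester_solution r A B C D E Y"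
      have "(\<Sum>t\<in>?S. ?K s t * (family_entry X t - family_entry Y t)) = 0" if "s \<in> ?S" for s
      proof -
        have "(\<Sum>t\<in>?S. ?K s t * family_entry X t) = family_entry E s"
          "(\<Sum>t\<in>?S. ?K s t * family_entry Y t) = family_entry E s"
          using X Y sol[of X E] sol[of Y E] E that by blast+
        thus ?thesis by (simp add: right_diff_distrib sum_subtractf)
      qed
      from trivial_kernelD[OF k this] have "family_entry X s = family_entry Y s" if "s \<in> ?S" for s
        using that by simp
      with X Y show "X = Y" by (blast intro: family_eqI)
    qed
  qed
qed

text \<open>Upper triangularity makes the coefficient of the entry \<open>(a, b)\<close> in the equation at \<open>(i, j)\<close>
  vanish unless \<open>a \<ge> i\<close> and \<open>b \<le> j\<close>. Numbering positions by rows, each row from right to left, is a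
  linear extension of this order, so that the system is block triangular with one scalar cyclic
  block for each position.\<close>
lemma trivial_kernel_upper_triangular:
  assumes r: "r \<ge> 1"
    and car: "\<And>k. k \<in> {1..r} \<Longrightarrow> A k \<in> carrier_mat n n" "\<And>k. k \<in> {1..r} \<Longrightarrow> B k \<in> carrier_mat n n"
    "\<And>k. k \<in> {1..r} \<Longrightarrow> C k \<in> carrier_mat n n" "\<And>k. k \<in> {1..r} \<Longrightarrow> D k \<in> carrier_mat n n"
    and tri: "\<And>k. k \<in> {1..r} \<Longrightarrow> upper_triangular (A k)"
    "\<And>k. k \<in> {1..r} \<Longrightarrow> upper_triangular (B k)"
    "\<And>k. k \<in> {1..r} \<Longrightarrow> upper_triangular (C k)"
    "\<And>k. k \<in> {1..r} \<Longrightarrow> upper_triangular (D k)"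
  shows "trivial_kernel (sylvester_coeff r A B C D) (entry_set n r) \<longleftrightarrow>
    (\<forall>i<n. \<forall>j<n. (\<Prod>k=1..r. A k $$ (i, i)) * (\<Prod>k=1..r. B k $$ (j, j))
       \<noteq> (\<Prod>k=1..r. C k $$ (i, i)) * (\<Prod>k=1..r. D k $$ (j, j)))"
proof -
  let ?S = "entry_set n r" and ?K = "sylvester_coeff r A B C D"
  define rank :: "nat \<times> nat \<times> nat \<Rightarrow> nat" where "rank = (\<lambda>(k, i, j). i * n + (n - 1 - j))"
  have row_less: "rank (k, i, j) < rank (l, a, b)" if "i < a" "j < n" for k l i j a b
  proof -
    have "rank (k, i, j) < Suc i * n" using that by (auto simp: rank_def)
    also have "\<dots> \<le> a * n" using that by (intro mult_le_mono1) simp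
    finally show ?thesis by (simp add: rank_def)
  qed
  have rank_eq: "i = a \<and> j = b" if "rank (k, i, j) = rank (l, a, b)" "j < n" "b < n" for k l i j a b
  proof -
    have "i = a" using that row_less[of i a j k l b] row_less[of a i b l k j] by (cases i a rule: linorder_cases) auto
    with that show ?thesis by (auto simp: rank_def)
  qed
  have "?K s t = 0" if st: "s \<in> ?S" "t \<in> ?S" and less: "rank t < rank s" for s t
  proof -
    obtain k i j l a b where s: "s = (k, i, j)" and t: "t = (l, a, b)" by (metis prod.exhaust)
    have b: "k \<in> {1..r}" "i < n" "j < n" "a < n" "b < n" using st by (auto simp: s t entry_set_def)
    show ?thesis
    proof (cases "a < i")
      case True
      hence "A k $$ (i, a) = 0" "C k $$ (i, a) = 0"
        using tri(1,3)[OF b(1)] car(1,3)[OF b(1)] b by auto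
      thus ?thesis by (simp add: s t sylvester_coeff_def)
    next
      case False
      have "j < b"
      proof (cases "a = i")
        case True thus ?thesis using less b by (auto simp: rank_def s t)
      next
        case False
        with \<open>\<not> a < i\<close> less row_less[of i a j k l b] b show ?thesis by (auto simp: s t)
      qed
      hence "B k $$ (b, j) = 0" "D k $$ (b, j) = 0"
        using tri(2,4)[OF b(1)] car(2,4)[OF b(1)] b by auto
      thus ?thesis by (simp add: s t sylvester_coeff_def)
    qed
  qed
  hence "trivial_kernel ?K ?S \<longleftrightarrow> (\<forall>m. trivial_kernel ?K {s \<in> ?S. rank s = m})"
    by (intro trivial_kernel_block_triangular) auto
  also have "\<dots> \<longleftrightarrow> (\<forall>i<n. \<forall>j<n. trivial_kernel ?K ({1..r} \<times> {i} \<times> {j}))"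
  proof -
    have blk: "{s \<in> ?S. rank s = rank (k, i, j)} = {1..r} \<times> {i} \<times> {j}"
      if "i < n" "j < n" for k i j
      using that by (auto simp: entry_set_def dest: rank_eq) (auto simp: rank_def)
    show ?thesis
    proof (intro iffI allI impI)
      fix i j assume *: "\<forall>m. trivial_kernel ?K {s \<in> ?S. rank s = m}" and ij: "i < n" "j < n"
      from *[rule_format, of "rank (1, i, j)"] show "trivial_kernel ?K ({1..r} \<times> {i} \<times> {j})"
        unfolding blk[OF ij] .
    next
      fix m assume *: "\<forall>i<n. \<forall>j<n. trivial_kernel ?K ({1..r} \<times> {i} \<times> {j})"
      show "trivial_kernel ?K {s \<in> ?S. rank s = m}"
      proof (cases "{s \<in> ?S. rank s = m} = {}")
        case True thus ?thesis unfolding trivial_kernel_def by blast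
      next
        case False
        then obtain k i j where "(k, i, j) \<in> ?S" "rank (k, i, j) = m" by auto
        hence ij: "i < n" "j < n" and m: "m = rank (k, i, j)" by (auto simp: entry_set_def)
        show ?thesis unfolding m blk[OF ij] using * ij by blast
      qed
    qed
  qed
  also have "\<dots> \<longleftrightarrow> (\<forall>i<n. \<forall>j<n. (\<Prod>k=1..r. A k $$ (i, i)) * (\<Prod>k=1..r. B k $$ (j, j))
       \<noteq> (\<Prod>k=1..r. C k $$ (i, i)) * (\<Prod>k=1..r. D k $$ (j, j)))"
  proof -
    have "trivial_kernel ?K ({1..r} \<times> {i} \<times> {j}) \<longleftrightarrow>
      (\<Prod>k=1..r. A k $$ (i, i)) * (\<Prod>k=1..r. B k $$ (j, j))
       \<noteq> (\<Prod>k=1..r. C k $$ (i, i)) * (\<Prod>k=1..r. D k $$ (j, j))" for i j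
    proof -
      have "bij_betw (\<lambda>k. (k, i, j)) {1..r} ({1..r} \<times> {i} \<times> {j})"
        by (rule bij_betwI[of _ _ _ fst]) auto
      from trivial_kernel_reindex[OF this, of ?K]
      show ?thesis
        using cyclic_scalar_trivial_kernel_iff[OF r,
            of "\<lambda>k. A k $$ (i, i) * B k $$ (j, j)" "\<lambda>k. C k $$ (i, i) * D k $$ (j, j)"]
        by (simp add: sylvester_coeff_def prod.distrib)
    qed
    thus ?thesis by simp
  qed
  finally show ?thesis .
qed

section \<open>Equivalence transformations of the system\<close>
lemma sylvester_nonsingular_iff_homogeneous:
  assumes r: "r \<ge> 1"
    and car: "\<And>k. k \<in> {1..r} \<Longrightarrow> A k \<in> carrier_mat n n" "\<And>k. k \<in> {1..r} \<Longrightarrow> B k \<in> carrier_mat n n"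
    "\<And>k. k \<in> {1..r} \<Longrightarrow> C k \<in> carrier_mat n n" "\<And>k. k \<in> {1..r} \<Longrightarrow> D k \<in> carrier_mat n n"
  shows "sylvester_nonsingular n r A B C D \<longleftrightarrow>
    (\<forall>X. (\<forall>k\<in>{1..r}. X k \<in> carrier_mat n n) \<longrightarrow>
      (\<forall>k\<in>{1..r}. A k * X k * B k - C k * X (cyc_succ r k) * D k = 0\<^sub>m n n) \<longrightarrow>
      (\<forall>k\<in>{1..r}. X k = 0\<^sub>m n n))"
proof (subst sylvester_nonsingular_iff_trivial_kernel[OF r], (fact car)+, intro iffI allI impI)
  fix X :: "nat \<Rightarrow> complex mat" assume tk: "trivial_kernel (sylvester_coeff r A B C D) (entry_set n r)"
    and X: "\<forall>k\<in>{1..r}. X k \<in> carrier_mat n n"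
    and eq: "\<forall>k\<in>{1..r}. A k * X k * B k - C k * X (cyc_succ r k) * D k = 0\<^sub>m n n"
  have "(\<Sum>t\<in>entry_set n r. sylvester_coeff r A B C D s t * family_entry X t) = 0"
    if "s \<in> entry_set n r" for s
  proof -
    from that obtain k i j where s: "s = (k, i, j)" "k \<in> {1..r}" "i < n" "j < n"
      by (auto simp: entry_set_def)
    show ?thesis unfolding s(1)
      by (subst sum_sylvester_coeff[OF car _ s(2-4)]) (use X eq s in auto)
  qed
  from trivial_kernelD[OF tk this]
  have z: "family_entry X s = 0" if "s \<in> entry_set n r" for s using that by blast
  show "\<forall>k\<in>{1..r}. X k = 0\<^sub>m n n"
  proof
    fix k assume k: "k \<in> {1..r}"
    show "X k = 0\<^sub>m n n"
      by (rule eq_matI) (use z[of "(k, _, _)"] X k in \<open>auto simp: entry_set_def family_entry_def\<close>)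
  qed
next
  assume *: "\<forall>X. (\<forall>k\<in>{1..r}. X k \<in> carrier_mat n n) \<longrightarrow>
      (\<forall>k\<in>{1..r}. A k * X k * B k - C k * X (cyc_succ r k) * D k = 0\<^sub>m n n) \<longrightarrow>
      (\<forall>k\<in>{1..r}. X k = 0\<^sub>m n n)"
  show "trivial_kernel (sylvester_coeff r A B C D) (entry_set n r)"
  proof (rule trivial_kernelI)
    fix y s
    assume y: "\<And>s. s \<in> entry_set n r \<Longrightarrow>
        (\<Sum>t\<in>entry_set n r. sylvester_coeff r A B C D s t * y t) = 0" and s: "s \<in> entry_set n r"
    define X where "X k = mat n n (\<lambda>(i, j). y (k, i, j))" for k
    have X: "X k \<in> carrier_mat n n" for k by (simp add: X_def)
    have e: "family_entry X t = y t" if "t \<in> entry_set n r" for t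
      using that by (auto simp: entry_set_def family_entry_def X_def)
    have "A k * X k * B k - C k * X (cyc_succ r k) * D k = 0\<^sub>m n n" if k: "k \<in> {1..r}" for k
    proof (rule eq_matI)
      fix i j assume "i < dim_row (0\<^sub>m n n)" "j < dim_col (0\<^sub>m n n)"
      hence ij: "i < n" "j < n" by auto
      have "(A k * X k * B k - C k * X (cyc_succ r k) * D k) $$ (i, j)
        = (\<Sum>t\<in>entry_set n r. sylvester_coeff r A B C D (k, i, j) t * family_entry X t)"
        using sum_sylvester_coeff[OF car X k ij] by simp
      also have "\<dots> = 0"
        using y[of "(k, i, j)"] k ij e by (simp add: entry_set_def)
      finally show "(A k * X k * B k - C k * X (cyc_succ r k) * D k) $$ (i, j) = 0\<^sub>m n n $$ (i, j)"
        using ij by simp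
    qed (use car[OF that] X in auto)
    with * X have "\<forall>k\<in>{1..r}. X k = 0\<^sub>m n n" by blast
    with e[OF s] s show "y s = 0" by (auto simp: entry_set_def family_entry_def)
  qed
qed

text \<open>The inverse is carried along explicitly because it is known in every use: it is the adjoint of
  a unitary matrix.\<close>
definition inverse_pair :: "nat \<Rightarrow> 'a::semiring_1 mat \<Rightarrow> 'a mat \<Rightarrow> bool" where
  "inverse_pair n U V \<longleftrightarrow> U \<in> carrier_mat n n \<and> V \<in> carrier_mat n n \<and> U * V = 1\<^sub>m n \<and> V * U = 1\<^sub>m n"

lemma inverse_pair_sym: "inverse_pair n U V \<Longrightarrow> inverse_pair n V U"
  by (auto simp: inverse_pair_def)

lemma inverse_pair_cancel:
  assumes "inverse_pair n P P'" "inverse_pair n U U'" "G \<in> carrier_mat n n"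
  shows "P' * (P * G * U) * U' = G"
proof -
  have c: "P \<in> carrier_mat n n" "P' \<in> carrier_mat n n" "U \<in> carrier_mat n n" "U' \<in> carrier_mat n n"
    and i: "P' * P = 1\<^sub>m n" "U * U' = 1\<^sub>m n"
    using assms by (auto simp: inverse_pair_def)
  have "P' * (P * G * U) * U' = (P' * P) * G * (U * U')"
    using c assms(3) by (simp add: assoc_mult_mat[of _ n n _ n _ n])
  thus ?thesis using assms(3) by (simp add: i)
qed

lemma inverse_pair_zero:
  assumes "inverse_pair n P P'" "inverse_pair n U U'" "G \<in> carrier_mat n n" "P * G * U = 0\<^sub>m n n"
  shows "G = 0\<^sub>m n n"
  using inverse_pair_cancel[OF assms(1-3)] assms(1,2,4) by (auto simp: inverse_pair_def)

lemma sylvester_nonsingular_transform_imp: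
  assumes r: "r \<ge> 1"
    and car: "\<And>k. k \<in> {1..r} \<Longrightarrow> A k \<in> carrier_mat n n" "\<And>k. k \<in> {1..r} \<Longrightarrow> B k \<in> carrier_mat n n"
    "\<And>k. k \<in> {1..r} \<Longrightarrow> C k \<in> carrier_mat n n" "\<And>k. k \<in> {1..r} \<Longrightarrow> D k \<in> carrier_mat n n"
    and P: "\<And>k. k \<in> {1..r} \<Longrightarrow> inverse_pair n (P k) (P' k)"
    and U: "\<And>k. k \<in> {1..r} \<Longrightarrow> inverse_pair n (U k) (U' k)"
    and V: "\<And>k. k \<in> {1..r} \<Longrightarrow> inverse_pair n (V k) (V' k)"
    and W: "\<And>k. k \<in> {1..r} \<Longrightarrow> inverse_pair n (W k) (W' k)"
    and ns: "sylvester_nonsingular n r A B C D"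
  shows "sylvester_nonsingular n r (\<lambda>k. P k * A k * U k) (\<lambda>k. V k * B k * W k)
    (\<lambda>k. P k * C k * U (cyc_succ r k)) (\<lambda>k. V (cyc_succ r k) * D k * W k)"
proof -
  have c: "P k \<in> carrier_mat n n" "U k \<in> carrier_mat n n" "V k \<in> carrier_mat n n" "W k \<in> carrier_mat n n"
    if "k \<in> {1..r}" for k
    using P[OF that] U[OF that] V[OF that] W[OF that] by (auto simp: inverse_pair_def)
  note sc = c(2,3)[OF cyc_range(1)]
  have car': "P k * A k * U k \<in> carrier_mat n n" "V k * B k * W k \<in> carrier_mat n n"
    "P k * C k * U (cyc_succ r k) \<in> carrier_mat n n" "V (cyc_succ r k) * D k * W k \<in> carrier_mat n n"
    if k: "k \<in> {1..r}" for k
    by (intro mult_carrier_mat[of _ n n] c[OF k] sc[OF k] car[OF k])+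
  show ?thesis
  proof (subst sylvester_nonsingular_iff_homogeneous[OF r], goal_cases)
    case 5
    show ?case
    proof (intro allI impI)
      fix X assume X: "\<forall>k\<in>{1..r}. X k \<in> carrier_mat n n"
        and eq: "\<forall>k\<in>{1..r}. P k * A k * U k * X k * (V k * B k * W k) -
           P k * C k * U (cyc_succ r k) * X (cyc_succ r k) * (V (cyc_succ r k) * D k * W k) = 0\<^sub>m n n"
      define Y where "Y k = U k * X k * V k" for k
      have Y: "Y k \<in> carrier_mat n n" if "k \<in> {1..r}" for k
        using c[OF that] X that by (auto simp: Y_def)
      have "A k * Y k * B k - C k * Y (cyc_succ r k) * D k = 0\<^sub>m n n" if k: "k \<in> {1..r}" for k
      proof (rule inverse_pair_zero[OF P[OF k] W[OF k]])
        note m = c[OF k] sc[OF k] car[OF k] X[rule_format, OF k] X[rule_format, OF cyc_range(1)[OF k]]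
          Y[OF k] Y[OF cyc_range(1)[OF k]]
        show "A k * Y k * B k - C k * Y (cyc_succ r k) * D k \<in> carrier_mat n n"
          using m by auto
        have 1: "P k * (A k * Y k * B k) * W k = P k * A k * U k * X k * (V k * B k * W k)"
          unfolding Y_def using m by (simp add: assoc_mult_mat[of _ n n _ n _ n])
        have 2: "P k * (C k * Y (cyc_succ r k) * D k) * W k
          = P k * C k * U (cyc_succ r k) * X (cyc_succ r k) * (V (cyc_succ r k) * D k * W k)"
          unfolding Y_def using m by (simp add: assoc_mult_mat[of _ n n _ n _ n])
        have "P k * (A k * Y k * B k - C k * Y (cyc_succ r k) * D k) * W k
          = P k * (A k * Y k * B k) * W k - P k * (C k * Y (cyc_succ r k) * D k) * W k"
          using m by (subst mult_minus_distrib_mat[of _ n n _ n], (auto)[3])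
            (subst minus_mult_distrib_mat[of _ n n], auto)
        thus "P k * (A k * Y k * B k - C k * Y (cyc_succ r k) * D k) * W k = 0\<^sub>m n n"
          unfolding 1 2 using eq k by simp
      qed
      moreover have "sylvester_nonsingular n r A B C D \<longleftrightarrow>
        (\<forall>X. (\<forall>k\<in>{1..r}. X k \<in> carrier_mat n n) \<longrightarrow>
          (\<forall>k\<in>{1..r}. A k * X k * B k - C k * X (cyc_succ r k) * D k = 0\<^sub>m n n) \<longrightarrow>
          (\<forall>k\<in>{1..r}. X k = 0\<^sub>m n n))"
        by (rule sylvester_nonsingular_iff_homogeneous[OF r]) (fact car)+
      ultimately have Y0: "\<forall>k\<in>{1..r}. Y k = 0\<^sub>m n n"
        using ns Y by simp
      show "\<forall>k\<in>{1..r}. X k = 0\<^sub>m n n"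
      proof
        fix k assume k: "k \<in> {1..r}"
        show "X k = 0\<^sub>m n n"
          by (rule inverse_pair_zero[OF U[OF k] V[OF k]]) (use X Y0 k in \<open>auto simp: Y_def\<close>)
      qed
    qed
  qed (fact car')+
qed

lemma sylvester_nonsingular_cong:
  assumes r: "r \<ge> 1"
    and "\<And>k. k \<in> {1..r} \<Longrightarrow> A k = A' k" "\<And>k. k \<in> {1..r} \<Longrightarrow> B k = B' k"
    "\<And>k. k \<in> {1..r} \<Longrightarrow> C k = C' k" "\<And>k. k \<in> {1..r} \<Longrightarrow> D k = D' k"
  shows "sylvester_nonsingular n r A B C D = sylvester_nonsingular n r A' B' C' D'"
  using assms unfolding sylvester_nonsingular_def sylvester_solution_cyc_succ[OF r] by simp

text \<open>The equations are multiplied by \<open>P\<^sub>k\<close> and \<open>W\<^sub>k\<close>, and the unknowns are replaced according to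
  \<open>X\<^sub>k = U\<^sub>k Y\<^sub>k V\<^sub>k\<close>. The matrices \<open>U\<close> and \<open>V\<close> occur with shifted index next to \<open>C\<close> and \<open>D\<close> because the
  second term of equation \<open>k\<close> contains \<open>X\<^bsub>k+1\<^esub>\<close>. The inverse transformation has the same form, so the
  one-sided version applied twice suffices.\<close>
lemma sylvester_nonsingular_transform:
  assumes r: "r \<ge> 1"
    and car: "\<And>k. k \<in> {1..r} \<Longrightarrow> A k \<in> carrier_mat n n" "\<And>k. k \<in> {1..r} \<Longrightarrow> B k \<in> carrier_mat n n"
    "\<And>k. k \<in> {1..r} \<Longrightarrow> C k \<in> carrier_mat n n" "\<And>k. k \<in> {1..r} \<Longrightarrow> D k \<in> carrier_mat n n"
    and P: "\<And>k. k \<in> {1..r} \<Longrightarrow> inverse_pair n (P k) (P' k)"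
    and U: "\<And>k. k \<in> {1..r} \<Longrightarrow> inverse_pair n (U k) (U' k)"
    and V: "\<And>k. k \<in> {1..r} \<Longrightarrow> inverse_pair n (V k) (V' k)"
    and W: "\<And>k. k \<in> {1..r} \<Longrightarrow> inverse_pair n (W k) (W' k)"
  shows "sylvester_nonsingular n r (\<lambda>k. P k * A k * U k) (\<lambda>k. V k * B k * W k)
    (\<lambda>k. P k * C k * U (cyc_succ r k)) (\<lambda>k. V (cyc_succ r k) * D k * W k)
    \<longleftrightarrow> sylvester_nonsingular n r A B C D" (is "?N' \<longleftrightarrow> ?N")
proof
  assume ?N'
  have c: "P k \<in> carrier_mat n n" "U k \<in> carrier_mat n n" "V k \<in> carrier_mat n n" "W k \<in> carrier_mat n n"
    if "k \<in> {1..r}" for k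
    using P[OF that] U[OF that] V[OF that] W[OF that] by (auto simp: inverse_pair_def)
  note sc = c(2,3)[OF cyc_range(1)]
  have car': "P k * A k * U k \<in> carrier_mat n n" "V k * B k * W k \<in> carrier_mat n n"
    "P k * C k * U (cyc_succ r k) \<in> carrier_mat n n" "V (cyc_succ r k) * D k * W k \<in> carrier_mat n n"
    if k: "k \<in> {1..r}" for k
    by (intro mult_carrier_mat[of _ n n] c[OF k] sc[OF k] car[OF k])+
  have "sylvester_nonsingular n r (\<lambda>k. P' k * (P k * A k * U k) * U' k)
    (\<lambda>k. V' k * (V k * B k * W k) * W' k)
    (\<lambda>k. P' k * (P k * C k * U (cyc_succ r k)) * U' (cyc_succ r k))
    (\<lambda>k. V' (cyc_succ r k) * (V (cyc_succ r k) * D k * W k) * W' k)"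
    by (rule sylvester_nonsingular_transform_imp[where P'=P and U'=U and V'=V and W'=W,
          OF r _ _ _ _ _ _ _ _ \<open>?N'\<close>])
      (fact car' P[THEN inverse_pair_sym] U[THEN inverse_pair_sym] V[THEN inverse_pair_sym]
        W[THEN inverse_pair_sym])+
  also have "?this \<longleftrightarrow> ?N"
  proof (rule sylvester_nonsingular_cong[OF r])
    fix k assume k: "k \<in> {1..r}"
    note k' = cyc_range(1)[OF k]
    show "P' k * (P k * A k * U k) * U' k = A k"
      by (rule inverse_pair_cancel[OF P[OF k] U[OF k] car(1)[OF k]])
    show "V' k * (V k * B k * W k) * W' k = B k"
      by (rule inverse_pair_cancel[OF V[OF k] W[OF k] car(2)[OF k]])
    show "P' k * (P k * C k * U (cyc_succ r k)) * U' (cyc_succ r k) = C k"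
      by (rule inverse_pair_cancel[OF P[OF k] U[OF k'] car(3)[OF k]])
    show "V' (cyc_succ r k) * (V (cyc_succ r k) * D k * W k) * W' k = D k"
      by (rule inverse_pair_cancel[OF V[OF k'] W[OF k] car(4)[OF k]])
  qed
  finally show ?N .
next
  assume ?N
  show ?N'
    by (rule sylvester_nonsingular_transform_imp[OF r _ _ _ _ _ _ _ _ \<open>?N\<close>])
      (fact car P U V W)+
qed

section \<open>Unitary matrices\<close>
lemma mat_adjoint_carrier [simp]:
  "A \<in> carrier_mat m n \<Longrightarrow> mat_adjoint A \<in> carrier_mat n m"
  unfolding mat_adjoint_def by (auto simp: mat_of_rows_def)

lemma index_mat_adjoint [simp]:
  "A \<in> carrier_mat m n \<Longrightarrow> i < n \<Longrightarrow> j < m \<Longrightarrow> mat_adjoint A $$ (i, j) = conjugate (A $$ (j, i))"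
  unfolding mat_adjoint_def by (simp add: mat_of_rows_def)

lemma dim_mat_adjoint [simp]:
  "dim_row (mat_adjoint A) = dim_col A" "dim_col (mat_adjoint A) = dim_row A"
  unfolding mat_adjoint_def by (auto simp: mat_of_rows_def)

lemma mat_adjoint_mult:
  fixes A B :: "'a::conjugatable_field mat"
  assumes "A \<in> carrier_mat n n" "B \<in> carrier_mat n n"
  shows "mat_adjoint (A * B) = mat_adjoint B * mat_adjoint A"
proof (rule eq_matI)
  have AB: "A * B \<in> carrier_mat n n" using assms by auto
  note c = mat_adjoint_carrier[OF assms(1)] mat_adjoint_carrier[OF assms(2)] mat_adjoint_carrier[OF AB]
  fix i j assume "i < dim_row (mat_adjoint B * mat_adjoint A)" "j < dim_col (mat_adjoint B * mat_adjoint A)"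
  hence ij: "i < n" "j < n" using c by auto
  have "mat_adjoint (A * B) $$ (i, j) = conjugate (\<Sum>k=0..<n. A $$ (j, k) * B $$ (k, i))"
    using index_mat_adjoint[OF AB ij] assms ij by (simp add: scalar_prod_def)
  also have "\<dots> = (\<Sum>k=0..<n. conjugate (B $$ (k, i)) * conjugate (A $$ (j, k)))"
    by (simp add: sum_conjugate conjugate_dist_mul mult.commute)
  also have "\<dots> = (mat_adjoint B * mat_adjoint A) $$ (i, j)"
    using c assms ij by (simp add: scalar_prod_def index_mat_adjoint[OF assms(1)] index_mat_adjoint[OF assms(2)])
  finally show "mat_adjoint (A * B) $$ (i, j) = (mat_adjoint B * mat_adjoint A) $$ (i, j)" .
qed (use assms mat_adjoint_carrier[of "A * B" n n] mat_adjoint_carrier[of A n n] mat_adjoint_carrier[of B n n] in auto)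

lemma unitary_mat_inverse_pair:
  "unitary_mat n U \<Longrightarrow> inverse_pair n U (mat_adjoint U)"
  by (auto simp: unitary_mat_def inverse_pair_def)

lemma unitary_mat_mult:
  assumes "unitary_mat n U" "unitary_mat n V"
  shows "unitary_mat n (U * V)"
proof -
  have c: "U \<in> carrier_mat n n" "V \<in> carrier_mat n n" "mat_adjoint U \<in> carrier_mat n n"
    "mat_adjoint V \<in> carrier_mat n n"
    and i: "mat_adjoint U * U = 1\<^sub>m n" "U * mat_adjoint U = 1\<^sub>m n"
      "mat_adjoint V * V = 1\<^sub>m n" "V * mat_adjoint V = 1\<^sub>m n"
    using assms by (auto simp: unitary_mat_def)
  have "mat_adjoint V * mat_adjoint U * (U * V) = mat_adjoint V * (mat_adjoint U * U) * V"
    "U * V * (mat_adjoint V * mat_adjoint U) = U * (V * mat_adjoint V) * mat_adjoint U"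
    using c by (simp_all add: assoc_mult_mat[of _ n n _ n _ n] mult_carrier_mat[of _ n n])
  thus ?thesis using c i by (simp add: unitary_mat_def mat_adjoint_mult)
qed

text \<open>Gram--Schmidt applied to a basis that starts with \<open>v\<close>, followed by normalization of the
  columns.\<close>
lemma unitary_mat_with_first_col:
  assumes v: "v \<in> carrier_vec n" "v \<noteq> 0\<^sub>v n"
  shows "\<exists>U c. unitary_mat n U \<and> c \<noteq> 0 \<and> col U 0 = c \<cdot>\<^sub>v v"
proof -
  interpret cof_vec_space n "TYPE(complex)" .
  define ws where "ws = gram_schmidt n (basis_completion v)"
  note bc = basis_completion[OF v]
  have ws: "corthogonal ws" "set ws \<subseteq> carrier_vec n" "length ws = n"
    using gram_schmidt_result[OF bc(2,4,5) ws_def] bc(6) by auto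
  have n: "n > 0"
  proof (rule ccontr)
    assume "\<not> n > 0" with v show False by (auto intro: eq_vecI)
  qed
  have "hd ws = v"
    using bc(6,7) n v(1) unfolding ws_def
    by (cases "basis_completion v") auto
  hence ws0: "ws ! 0 = v" using ws(3) n by (cases ws) auto
  have wc: "ws ! i \<in> carrier_vec n" if "i < n" for i using ws that by auto
  define N where "N i = ws ! i \<bullet>c ws ! i" for i
  have N: "N i = (\<Sum>k=0..<n. complex_of_real ((cmod (ws ! i $ k))\<^sup>2))" if "i < n" for i
    using wc[OF that] by (auto simp: N_def scalar_prod_def complex_norm_square simp del: of_real_power intro!: sum.cong)
  have Nre: "N i = complex_of_real (Re (N i))" "Re (N i) \<ge> 0" if "i < n" for i
    unfolding N[OF that] by (auto simp: sum_nonneg)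
  have Npos: "Re (N i) > 0" if "i < n" for i
  proof -
    have "N i \<noteq> 0" using corthogonalD[OF ws(1), of i i] ws(3) that by (simp add: N_def)
    with Nre[OF that] show ?thesis by (metis less_eq_real_def of_real_0)
  qed
  define s where "s i = complex_of_real (1 / sqrt (Re (N i)))" for i
  have s: "s i \<noteq> 0" "cnj (s i) = s i" "s i * s i * N i = 1" if "i < n" for i
  proof -
    show "s i \<noteq> 0" "cnj (s i) = s i" using Npos[OF that] by (auto simp: s_def)
    have "s i * s i * N i = complex_of_real (1 / sqrt (Re (N i)) * (1 / sqrt (Re (N i))) * Re (N i))"
      by (subst Nre(1)[OF that]) (simp only: s_def of_real_mult)
    also have "1 / sqrt (Re (N i)) * (1 / sqrt (Re (N i))) * Re (N i) = 1"
      using Npos[OF that] by simp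
    also have "complex_of_real 1 = 1" by simp
    finally show "s i * s i * N i = 1" .
  qed
  define U where "U = mat n n (\<lambda>(i, j). s j * ws ! j $ i)"
  have U: "U \<in> carrier_mat n n" by (simp add: U_def)
  have "mat_adjoint U * U = 1\<^sub>m n"
  proof (rule eq_matI)
    fix i j assume "i < dim_row (1\<^sub>m n :: complex mat)" "j < dim_col (1\<^sub>m n :: complex mat)"
    hence ij: "i < n" "j < n" by auto
    have "(mat_adjoint U * U) $$ (i, j) = (\<Sum>k=0..<n. cnj (s i * ws ! i $ k) * (s j * ws ! j $ k))"
    proof -
      have "mat_adjoint U $$ (i, k) = cnj (s i * ws ! i $ k)" "U $$ (k, j) = s j * ws ! j $ k"
        if "k < n" for k
        using index_mat_adjoint[OF U ij(1) that] ij that by (simp_all add: U_def)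
      thus ?thesis using ij U by (simp add: scalar_prod_def)
    qed
    also have "\<dots> = s i * s j * (\<Sum>k=0..<n. ws ! j $ k * cnj (ws ! i $ k))"
      using s(2)[OF ij(1)] by (simp add: sum_distrib_left mult_ac)
    also have "(\<Sum>k=0..<n. ws ! j $ k * cnj (ws ! i $ k)) = ws ! j \<bullet>c ws ! i"
      using wc[OF ij(1)] wc[OF ij(2)] by (auto simp: scalar_prod_def intro!: sum.cong)
    also have "s i * s j * \<dots> = 1\<^sub>m n $$ (i, j)"
    proof (cases "i = j")
      case True thus ?thesis using s(3)[OF ij(1)] ij by (simp add: N_def)
    next
      case False
      hence "ws ! j \<bullet>c ws ! i = 0" using corthogonalD[OF ws(1), of j i] ws(3) ij by auto
      thus ?thesis using False ij by simp
    qed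
    finally show "(mat_adjoint U * U) $$ (i, j) = 1\<^sub>m n $$ (i, j)" .
  qed (use U mat_adjoint_carrier[OF U] in auto)
  hence "unitary_mat n U"
    using U mat_mult_left_right_inverse[OF mat_adjoint_carrier[OF U] U] by (simp add: unitary_mat_def)
  moreover have "col U 0 = s 0 \<cdot>\<^sub>v v"
    using n v(1) by (intro eq_vecI) (auto simp: U_def ws0)
  ultimately show ?thesis using s(1)[OF n] by blast
qed

section \<open>Lines preserved around a cycle\<close>
lemma chain_forward:
  assumes step: "\<And>k x. a \<le> k \<Longrightarrow> k < b \<Longrightarrow> x \<in> V \<Longrightarrow> \<exists>y\<in>V. P k x y"
    and ab: "a \<le> b" and x: "x \<in> V"
  shows "\<exists>z. z a = x \<and> (\<forall>k\<in>{a..b}. z k \<in> V) \<and> (\<forall>k\<in>{a..<b}. P k (z k) (z (Suc k)))"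
  using ab step
proof (induction b rule: dec_induct)
  case base
  show ?case using x by (intro exI[of _ "\<lambda>_. x"]) auto
next
  case (step b)
  then obtain z where z: "z a = x" "\<And>k. k \<in> {a..b} \<Longrightarrow> z k \<in> V"
    "\<And>k. k \<in> {a..<b} \<Longrightarrow> P k (z k) (z (Suc k))"
    by (metis less_SucI)
  obtain y where y: "y \<in> V" "P b (z b) y" using step.prems[of b "z b"] z(2)[of b] step.hyps by auto
  show ?case
    by (rule exI[of _ "z(Suc b := y)"]) (use z y step.hyps in \<open>auto simp: le_Suc_eq less_Suc_eq\<close>)
qed

text \<open>The condition at \<open>q\<close> holds for \<open>y\<close> regardless of the vector before it. Starting at position
  \<open>q + 1\<close> with \<open>y\<close>, the chain is therefore continued step by step around the cycle to position \<open>q\<close>,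
  where nothing remains to be matched.\<close>
lemma cyclic_chain_forward:
  assumes step: "\<And>k x. 1 \<le> k \<Longrightarrow> k \<le> p \<Longrightarrow> x \<in> V \<Longrightarrow> \<exists>y\<in>V. P k x y"
    and q: "1 \<le> q" "q \<le> p" and y: "y \<in> V" "\<And>x. x \<in> V \<Longrightarrow> P q x y"
  shows "\<exists>z. z (Suc p) = z 1 \<and> (\<forall>k\<in>{1..Suc p}. z k \<in> V) \<and> (\<forall>k\<in>{1..p}. P k (z k) (z (Suc k)))"
proof -
  have "\<exists>u. u (Suc q) = y \<and> (\<forall>k\<in>{Suc q..Suc p}. u k \<in> V) \<and>
      (\<forall>k\<in>{Suc q..<Suc p}. P k (u k) (u (Suc k)))"
    by (rule chain_forward) (use step q y in auto)
  then obtain u where u: "u (Suc q) = y" "\<And>k. k \<in> {Suc q..Suc p} \<Longrightarrow> u k \<in> V"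
    "\<And>k. k \<in> {Suc q..<Suc p} \<Longrightarrow> P k (u k) (u (Suc k))"
    by blast
  have up: "u (Suc p) \<in> V" using u(2) q by simp
  have "\<exists>v. v 1 = u (Suc p) \<and> (\<forall>k\<in>{1..q}. v k \<in> V) \<and> (\<forall>k\<in>{1..<q}. P k (v k) (v (Suc k)))"
    by (rule chain_forward) (use step q up in auto)
  then obtain v where v: "v 1 = u (Suc p)" "\<And>k. k \<in> {1..q} \<Longrightarrow> v k \<in> V"
    "\<And>k. k \<in> {1..<q} \<Longrightarrow> P k (v k) (v (Suc k))"
    by blast
  show ?thesis
  proof (rule exI[of _ "\<lambda>k. if k \<le> q then v k else u k"], intro conjI ballI)
    fix k assume k: "k \<in> {1..p}"
    consider "k < q" | "k = q" | "q < k" by linarith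
    thus "P k (if k \<le> q then v k else u k) (if Suc k \<le> q then v (Suc k) else u (Suc k))"
      by cases (use k u v y q in auto)
  qed (use q u v in auto)
qed

lemma cyclic_chain_backward:
  assumes step: "\<And>k y. 1 \<le> k \<Longrightarrow> k \<le> p \<Longrightarrow> y \<in> V \<Longrightarrow> \<exists>x\<in>V. P k x y"
    and q: "1 \<le> q" "q \<le> p" and x: "x \<in> V" "\<And>y. y \<in> V \<Longrightarrow> P q x y"
  shows "\<exists>z. z (Suc p) = z 1 \<and> (\<forall>k\<in>{1..Suc p}. z k \<in> V) \<and> (\<forall>k\<in>{1..p}. P k (z k) (z (Suc k)))"
proof -
  have "\<exists>z. z (Suc p) = z 1 \<and> (\<forall>k\<in>{1..Suc p}. z k \<in> V) \<and>
      (\<forall>k\<in>{1..p}. P (Suc p - k) (z (Suc k)) (z k))"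
    by (rule cyclic_chain_forward[where P = "\<lambda>k x y. P (Suc p - k) y x" and q = "Suc p - q"])
      (use step q x in auto)
  then obtain z where z: "z (Suc p) = z 1" "\<And>k. k \<in> {1..Suc p} \<Longrightarrow> z k \<in> V"
    "\<And>k. k \<in> {1..p} \<Longrightarrow> P (Suc p - k) (z (Suc k)) (z k)"
    by blast
  show ?thesis
  proof (rule exI[of _ "\<lambda>k. z (Suc (Suc p) - k)"], intro conjI ballI)
    fix k assume k: "k \<in> {1..p}"
    have m: "Suc p - k \<in> {1..p}" and e: "Suc p - (Suc p - k) = k"
      "Suc (Suc p - k) = Suc (Suc p) - k" "Suc p - k = Suc (Suc p) - Suc k" using k by auto
    show "P k (z (Suc (Suc p) - k)) (z (Suc (Suc p) - Suc k))"
      using z(3)[OF m] unfolding e(1,2) unfolding e(3) .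
  next
    fix k assume "k \<in> {1..Suc p}"
    hence "Suc (Suc p) - k \<in> {1..Suc p}" by auto
    thus "z (Suc (Suc p) - k) \<in> V" by (rule z(2))
  qed (use z(1) in simp)
qed

text \<open>The vector \<open>w\<close> is named, instead of stating that \<open>M x\<close> and \<open>N y\<close> are linearly dependent, because
  it gives the first column of the unitary matrix \<open>Q\<^sub>k\<close>.\<close>
definition common_line ::
  "nat \<Rightarrow> complex mat \<Rightarrow> complex mat \<Rightarrow> complex vec \<Rightarrow> complex vec \<Rightarrow> bool" where
  "common_line n M N x y \<longleftrightarrow> (\<exists>w \<alpha> \<beta>. w \<in> carrier_vec n \<and> w \<noteq> 0\<^sub>v n \<and>
     M *\<^sub>v x = \<alpha> \<cdot>\<^sub>v w \<and> N *\<^sub>v y = \<beta> \<cdot>\<^sub>v w)"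

lemma common_line_commute: "common_line n M N x y \<longleftrightarrow> common_line n N M y x"
  unfolding common_line_def by blast

lemma smult_zero_vec: "w \<in> carrier_vec n \<Longrightarrow> (0 :: complex) \<cdot>\<^sub>v w = 0\<^sub>v n"
  by (intro eq_vecI) auto

lemma common_lineI:
  assumes car: "M \<in> carrier_mat n n" "N \<in> carrier_mat n n" "x \<in> carrier_vec n" "y \<in> carrier_vec n"
    and y: "y \<noteq> 0\<^sub>v n"
    and dep: "M *\<^sub>v x = 0\<^sub>v n \<or> N *\<^sub>v y = 0\<^sub>v n \<or> (\<exists>c. N *\<^sub>v y = c \<cdot>\<^sub>v (M *\<^sub>v x))"
  shows "common_line n M N x y"
proof -
  have c: "M *\<^sub>v x \<in> carrier_vec n" "N *\<^sub>v y \<in> carrier_vec n" using car by auto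
  consider "M *\<^sub>v x = 0\<^sub>v n" "N *\<^sub>v y = 0\<^sub>v n" | "M *\<^sub>v x = 0\<^sub>v n" "N *\<^sub>v y \<noteq> 0\<^sub>v n"
    | "M *\<^sub>v x \<noteq> 0\<^sub>v n" "N *\<^sub>v y = 0\<^sub>v n" | c where "M *\<^sub>v x \<noteq> 0\<^sub>v n" "N *\<^sub>v y = c \<cdot>\<^sub>v (M *\<^sub>v x)"
    using dep by blast
  thus ?thesis
  proof cases
    case 1 thus ?thesis unfolding common_line_def
      using y car by (intro exI[of _ y] exI[of _ 0]) (auto simp: smult_zero_vec)
  next
    case 2 thus ?thesis unfolding common_line_def
      using c by (intro exI[of _ "N *\<^sub>v y"] exI[of _ 0] exI[of _ 1]) (auto simp: smult_zero_vec)
  next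
    case 3 thus ?thesis unfolding common_line_def
      using c by (intro exI[of _ "M *\<^sub>v x"] exI[of _ 1] exI[of _ 0]) (auto simp: smult_zero_vec)
  next
    case (4 a) thus ?thesis unfolding common_line_def
      using c by (intro exI[of _ "M *\<^sub>v x"] exI[of _ 1] exI[of _ a]) auto
  qed
qed

lemma det_nonzero_mult_vec:
  assumes "(M :: 'a::field mat) \<in> carrier_mat n n" "det M \<noteq> 0" "x \<in> carrier_vec n" "x \<noteq> 0\<^sub>v n"
  shows "M *\<^sub>v x \<noteq> 0\<^sub>v n"
  using assms det_0_iff_vec_prod_zero_field[OF assms(1)] by blast

lemma det_nonzero_right_inverse:
  assumes "(N :: 'a::field mat) \<in> carrier_mat n n" "det N \<noteq> 0"
  shows "\<exists>B. B \<in> carrier_mat n n \<and> N * B = 1\<^sub>m n"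
  using det_non_zero_imp_unit[OF assms, of "()"] unfolding Units_def ring_mat_def by auto

lemma mult_mat_zero_vec:
  "(N :: 'a::semiring_1 mat) \<in> carrier_mat m n \<Longrightarrow> N *\<^sub>v 0\<^sub>v n = 0\<^sub>v m"
  by (intro eq_vecI) auto

text \<open>If \<open>N\<close> is singular, any kernel vector of \<open>N\<close> serves as \<open>y\<close>; otherwise \<open>y = N\<^sup>-\<^sup>1 M x\<close> does, unless
  it is zero, in which case \<open>M x = 0\<close> and any nonzero \<open>y\<close> works.\<close>
lemma common_line_step:
  assumes M: "M \<in> carrier_mat n n" and N: "N \<in> carrier_mat n n"
    and x: "x \<in> carrier_vec n" "x \<noteq> 0\<^sub>v n"
  shows "\<exists>y\<in>carrier_vec n - {0\<^sub>v n}. common_line n M N x y"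
proof (cases "det N = 0")
  case True
  then obtain y where "y \<in> carrier_vec n" "y \<noteq> 0\<^sub>v n" "N *\<^sub>v y = 0\<^sub>v n"
    using det_0_iff_vec_prod_zero_field[OF N] by blast
  thus ?thesis using common_lineI[OF M N x(1)] by (intro bexI[of _ y]) auto
next
  case False
  show ?thesis
  proof (cases "M *\<^sub>v x = 0\<^sub>v n")
    case True
    thus ?thesis using x common_lineI[OF M N x(1) x(1)] by (intro bexI[of _ x]) auto
  next
    case ne: False
    obtain B where B: "B \<in> carrier_mat n n" "N * B = 1\<^sub>m n"
      using det_nonzero_right_inverse[OF N False] by blast
    define y where "y = B *\<^sub>v (M *\<^sub>v x)"
    have Mx: "M *\<^sub>v x \<in> carrier_vec n" using M x by auto
    have y: "y \<in> carrier_vec n" using B Mx by (auto simp: y_def)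
    have Ny: "N *\<^sub>v y = M *\<^sub>v x"
      unfolding y_def using B N Mx by (simp flip: assoc_mult_mat_vec)
    have "y \<noteq> 0\<^sub>v n" using Ny ne mult_mat_zero_vec[OF N] by metis
    moreover have "N *\<^sub>v y = 1 \<cdot>\<^sub>v (M *\<^sub>v x)" using Ny Mx by simp
    ultimately show ?thesis using common_lineI[OF M N x(1) y] y by blast
  qed
qed

text \<open>The vectors are \<open>z\<^bsub>k+1\<^esub> = N\<^sub>k\<^sup>-\<^sup>1 M\<^sub>k z\<^sub>k\<close>, starting at an eigenvector of the full product; all are
  nonzero by invertibility, and the eigenvalue equation closes the cycle up to a scalar, which does
  not affect lines.\<close>
lemma cyclic_common_lines_invertible:
  assumes n: "n > 0"
    and M: "\<And>k. 1 \<le> k \<Longrightarrow> k \<le> p \<Longrightarrow> M k \<in> carrier_mat n n \<and> det (M k) \<noteq> 0"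
    and N: "\<And>k. 1 \<le> k \<Longrightarrow> k \<le> p \<Longrightarrow> N k \<in> carrier_mat n n \<and> det (N k) \<noteq> 0"
  shows "\<exists>z. z (Suc p) = z 1 \<and> (\<forall>k\<in>{1..Suc p}. z k \<in> carrier_vec n - {0\<^sub>v n}) \<and>
    (\<forall>k\<in>{1..p}. common_line n (M k) (N k) (z k) (z (Suc k)))"
proof -
  have "\<exists>B. \<forall>k\<in>{1..p}. B k \<in> carrier_mat n n \<and> N k * B k = 1\<^sub>m n"
    by (intro bchoice ballI det_nonzero_right_inverse) (use N in auto)
  then obtain B where B: "\<And>k. 1 \<le> k \<Longrightarrow> k \<le> p \<Longrightarrow> B k \<in> carrier_mat n n \<and> N k * B k = 1\<^sub>m n"
    by (meson atLeastAtMost_iff)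
  define G where "G = rec_nat (1\<^sub>m n) (\<lambda>k g. B (Suc k) * M (Suc k) * g)"
  have G0: "G 0 = 1\<^sub>m n" and GS: "G (Suc k) = B (Suc k) * M (Suc k) * G k" for k
    by (simp_all add: G_def)
  have G: "G k \<in> carrier_mat n n" if "k \<le> p" for k
    using that
  proof (induction k)
    case (Suc k) thus ?case using B[of "Suc k"] M[of "Suc k"] by (auto simp: GS)
  qed (simp add: G0)
  obtain e where "e \<in> spectrum (G p)" using spectrum_non_empty[OF G n] by auto
  then obtain v where v: "v \<in> carrier_vec n" "v \<noteq> 0\<^sub>v n" "G p *\<^sub>v v = e \<cdot>\<^sub>v v"
    using G[of p] unfolding spectrum_def eigenvalue_def eigenvector_def by auto
  define g where "g k = G k *\<^sub>v v" for k
  have gc: "g k \<in> carrier_vec n" if "k \<le> p" for k using G[OF that] v by (auto simp: g_def)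
  have Ng: "N (Suc k) *\<^sub>v g (Suc k) = M (Suc k) *\<^sub>v g k" if "k < p" for k
  proof -
    note c = B[of "Suc k"] M[of "Suc k"] N[of "Suc k"] G[of k]
    have "g (Suc k) = B (Suc k) *\<^sub>v (M (Suc k) *\<^sub>v g k)"
      unfolding g_def GS using c that v
      by (simp add: assoc_mult_mat_vec[of _ n n _ n] mult_carrier_mat[of _ n n _ n])
    hence "N (Suc k) *\<^sub>v g (Suc k) = (N (Suc k) * B (Suc k)) *\<^sub>v (M (Suc k) *\<^sub>v g k)"
      using assoc_mult_mat_vec[of "N (Suc k)" n n "B (Suc k)" n "M (Suc k) *\<^sub>v g k"]
        mult_mat_vec_carrier[of "M (Suc k)" n n "g k"] c that gc[of k] by simp
    thus ?thesis
      using c that gc[of k] mult_mat_vec_carrier[of "M (Suc k)" n n "g k"] by simp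
  qed
  have g0: "g k \<noteq> 0\<^sub>v n" if "k \<le> p" for k
    using that
  proof (induction k)
    case 0 thus ?case using v by (simp add: g_def G0)
  next
    case (Suc k)
    hence "M (Suc k) *\<^sub>v g k \<noteq> 0\<^sub>v n"
      using M[of "Suc k"] gc[of k] by (intro det_nonzero_mult_vec) auto
    thus ?case using Ng[of k] Suc.prems mult_mat_zero_vec[of "N (Suc k)" n n] N[of "Suc k"]
      by (metis Suc_le_eq Suc_le_mono le0 One_nat_def)
  qed
  define z where "z k = (if k = Suc p then v else g (k - 1))" for k
  have z1: "z 1 = v" using v by (simp add: z_def g_def G0)
  have zc: "z k \<in> carrier_vec n \<and> z k \<noteq> 0\<^sub>v n" if "k \<in> {1..Suc p}" for k
  proof (cases "k = Suc p")
    case True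
    thus ?thesis using v by (simp add: z_def)
  next
    case False
    hence "k - 1 \<le> p" using that by auto
    from gc[OF this] g0[OF this] False show ?thesis by (simp add: z_def)
  qed
  have "common_line n (M k) (N k) (z k) (z (Suc k))" if k: "k \<in> {1..p}" for k
  proof -
    obtain m where m: "k = Suc m" using k by (cases k) auto
    hence mp: "m < p" using k by auto
    note Mk = M[of k] and Nk = N[of k] and zk = zc[of k]
    show ?thesis
    proof (cases "k = p")
      case False
      have "N k *\<^sub>v z (Suc k) = 1 \<cdot>\<^sub>v (M k *\<^sub>v z k)"
        using Ng[OF mp] k False Mk zk mult_mat_vec_carrier[of "M k" n n "z k"]
        by (simp add: z_def m)
      hence dep: "M k *\<^sub>v z k = 0\<^sub>v n \<or> N k *\<^sub>v z (Suc k) = 0\<^sub>v n \<or>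
          (\<exists>c. N k *\<^sub>v z (Suc k) = c \<cdot>\<^sub>v (M k *\<^sub>v z k))"
        by blast
      show ?thesis
        by (rule common_lineI[OF _ _ _ _ _ dep]) (use zk zc[of "Suc k"] k Mk Nk in auto)
    next
      case True
      have "z k = g m" using m mp by (simp add: z_def)
      moreover have "g k = e \<cdot>\<^sub>v v" using v(3) by (simp add: g_def True)
      ultimately have "M k *\<^sub>v z k = N k *\<^sub>v (e \<cdot>\<^sub>v v)"
        using Ng[OF mp] unfolding m by simp
      also have "\<dots> = e \<cdot>\<^sub>v (N k *\<^sub>v v)"
        using Nk k v(1) by (intro mult_mat_vec) auto
      finally have "common_line n (N k) (M k) v (z k)"
        using zk k Mk Nk v by (intro common_lineI disjI2) auto
      thus ?thesis unfolding common_line_commute[of n "M k"] using True by (simp add: z_def)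
    qed
  qed
  thus ?thesis using z1 zc by (intro exI[of _ z]) (auto simp: z_def)
qed

text \<open>A singular factor makes the closing condition automatic: a kernel vector of \<open>N\<^sub>q\<close> is related to
  everything before it, a kernel vector of \<open>M\<^sub>q\<close> to everything after it. The remaining case is the
  invertible one.\<close>
lemma cyclic_common_lines:
  assumes n: "n > 0"
    and M: "\<And>k. 1 \<le> k \<Longrightarrow> k \<le> p \<Longrightarrow> M k \<in> carrier_mat n n"
    and N: "\<And>k. 1 \<le> k \<Longrightarrow> k \<le> p \<Longrightarrow> N k \<in> carrier_mat n n"
  shows "\<exists>z. z (Suc p) = z 1 \<and> (\<forall>k\<in>{1..Suc p}. z k \<in> carrier_vec n - {0\<^sub>v n}) \<and>
    (\<forall>k\<in>{1..p}. common_line n (M k) (N k) (z k) (z (Suc k)))"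
proof -
  let ?V = "carrier_vec n - {0\<^sub>v n} :: complex vec set"
  have fwd: "\<exists>y\<in>?V. common_line n (M k) (N k) x y" if "1 \<le> k" "k \<le> p" "x \<in> ?V" for k x
    using common_line_step[OF M N, of k k x] that by auto
  have bwd: "\<exists>x\<in>?V. common_line n (M k) (N k) x y" if "1 \<le> k" "k \<le> p" "y \<in> ?V" for k y
    using common_line_step[OF N M, of k k y] that by (auto simp: common_line_commute[of n "M k"])
  consider (N) q where "1 \<le> q" "q \<le> p" "det (N q) = 0" | (M) q where "1 \<le> q" "q \<le> p" "det (M q) = 0"
    | (inv) "\<And>k. 1 \<le> k \<Longrightarrow> k \<le> p \<Longrightarrow> det (M k) \<noteq> 0 \<and> det (N k) \<noteq> 0" by blast
  thus ?thesis
  proof cases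
    case (N q)
    note Nq = assms(3)[OF N(1,2)] and Mq = assms(2)[OF N(1,2)]
    obtain y where y: "y \<in> carrier_vec n" "y \<noteq> 0\<^sub>v n" "N q *\<^sub>v y = 0\<^sub>v n"
      using det_0_iff_vec_prod_zero_field[OF Nq] N(3) by blast
    have cl: "common_line n (M q) (N q) x y" if "x \<in> ?V" for x
      using that y by (intro common_lineI Mq Nq) auto
    have yV: "y \<in> ?V" using y by simp
    show ?thesis
      by (rule cyclic_chain_forward[where q = q and y = y]) (fact fwd N(1,2) yV cl)+
  next
    case (M q)
    note Nq = assms(3)[OF M(1,2)] and Mq = assms(2)[OF M(1,2)]
    obtain x where x: "x \<in> carrier_vec n" "x \<noteq> 0\<^sub>v n" "M q *\<^sub>v x = 0\<^sub>v n"
      using det_0_iff_vec_prod_zero_field[OF Mq] M(3) by blast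
    have cl: "common_line n (M q) (N q) x y" if "y \<in> ?V" for y
      using that x by (intro common_lineI Mq Nq) auto
    have xV: "x \<in> ?V" using x by simp
    show ?thesis
      by (rule cyclic_chain_backward[where q = q and x = x]) (fact bwd M(1,2) xV cl)+
  next
    case inv
    thus ?thesis using M N by (intro cyclic_common_lines_invertible[OF n]) auto
  qed
qed

section \<open>Existence of periodic Schur decompositions\<close>
definition border :: "nat \<Rightarrow> 'a::semiring_1 mat \<Rightarrow> 'a mat" where
  "border n U = four_block_mat (1\<^sub>m 1) (0\<^sub>m 1 n) (0\<^sub>m n 1) U"

lemma border_carrier [simp]: "U \<in> carrier_mat n n \<Longrightarrow> border n U \<in> carrier_mat (Suc n) (Suc n)"
  unfolding border_def using four_block_carrier_mat[of "1\<^sub>m 1" 1 1 U n n] by simp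

lemma border_mult:
  assumes "U \<in> carrier_mat n n" "V \<in> carrier_mat n n"
  shows "border n U * border n V = border n (U * V)"
  unfolding border_def using assms
  by (subst mult_four_block_mat[where ?nr1.0 = 1 and ?n1.0 = 1 and ?n2.0 = n and ?nr2.0 = n
        and ?nc1.0 = 1 and ?nc2.0 = n]) auto

lemma border_one: "border n (1\<^sub>m n) = 1\<^sub>m (Suc n)"
  unfolding border_def by simp

lemma mat_adjoint_border:
  fixes U :: "complex mat"
  assumes U: "U \<in> carrier_mat n n"
  shows "mat_adjoint (border n U) = border n (mat_adjoint U)"
proof -
  note c = mat_adjoint_carrier[OF border_carrier[OF U]] border_carrier[OF mat_adjoint_carrier[OF U]]
  show ?thesis
  proof (rule eq_matI)
    fix i j assume "i < dim_row (border n (mat_adjoint U))" "j < dim_col (border n (mat_adjoint U))"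
    hence "i < Suc n" "j < Suc n" using c by auto
    thus "mat_adjoint (border n U) $$ (i, j) = border n (mat_adjoint U) $$ (i, j)"
      using U mat_adjoint_carrier[OF U]
      by (subst index_mat_adjoint[OF border_carrier[OF U]]) (auto simp: border_def)
  qed (use c in auto)
qed

lemma unitary_mat_border:
  assumes "unitary_mat n U"
  shows "unitary_mat (Suc n) (border n U)"
  using assms by (simp add: unitary_mat_def mat_adjoint_border border_mult border_one)

definition deflate :: "nat \<Rightarrow> 'a mat \<Rightarrow> 'a mat" where
  "deflate n G = mat n n (\<lambda>(i, j). G $$ (Suc i, Suc j))"

lemma deflate_carrier [simp]: "deflate n G \<in> carrier_mat n n"
  by (simp add: deflate_def)

lemma upper_triangular_deflation:
  fixes G :: "'a::comm_ring_1 mat"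
  assumes G: "G \<in> carrier_mat (Suc n) (Suc n)" and col: "\<And>i. i < n \<Longrightarrow> G $$ (Suc i, 0) = 0"
    and Q: "Q \<in> carrier_mat n n" and Z: "Z \<in> carrier_mat n n"
    and ut: "upper_triangular (Q * deflate n G * Z)"
  shows "upper_triangular (border n Q * G * border n Z)"
proof -
  define a where "a = mat 1 1 (\<lambda>_. G $$ (0, 0))"
  define b where "b = mat 1 n (\<lambda>(i, j). G $$ (0, Suc j))"
  have c: "a \<in> carrier_mat 1 1" "b \<in> carrier_mat 1 n" by (auto simp: a_def b_def)
  have Gb: "G = four_block_mat a b (0\<^sub>m n 1) (deflate n G)"
  proof (rule eq_matI)
    fix i j assume "i < dim_row (four_block_mat a b (0\<^sub>m n 1) (deflate n G))"
      "j < dim_col (four_block_mat a b (0\<^sub>m n 1) (deflate n G))"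
    thus "G $$ (i, j) = four_block_mat a b (0\<^sub>m n 1) (deflate n G) $$ (i, j)"
      using col by (cases i; cases j) (auto simp: a_def b_def deflate_def)
  qed (use G in \<open>auto simp: a_def deflate_def\<close>)
  have "border n Q * G = four_block_mat a b (0\<^sub>m n 1) (Q * deflate n G)"
    by (subst Gb, unfold border_def, subst mult_four_block_mat[where ?nr1.0 = 1 and ?n1.0 = 1
          and ?n2.0 = n and ?nr2.0 = n and ?nc1.0 = 1 and ?nc2.0 = n])
      (use c Q in \<open>auto simp: left_mult_zero_mat[OF deflate_carrier]\<close>)
  moreover have "Q * deflate n G \<in> carrier_mat n n" "Q * deflate n G * Z \<in> carrier_mat n n"
    using Q Z by (auto intro: mult_carrier_mat)
  ultimately have "border n Q * G * border n Z
      = four_block_mat a (b * Z) (0\<^sub>m n 1) (Q * deflate n G * Z)"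
    by (simp only:, unfold border_def, subst mult_four_block_mat[where ?nr1.0 = 1 and ?n1.0 = 1
          and ?n2.0 = n and ?nr2.0 = n and ?nc1.0 = 1 and ?nc2.0 = n])
      (use c Q Z in \<open>auto simp: right_mult_zero_mat[of _ n n] left_add_zero_mat[of _ n n]\<close>)
  moreover have "upper_triangular \<dots>"
    by (rule upper_triangular_four_block[OF c(1) _ _ ut]) (use c Q Z in auto)
  ultimately show ?thesis by simp
qed

text \<open>The map \<open>M\<close> sends the line of the first column of \<open>U\<close> into the line of the first column of \<open>W\<close>, which
  \<open>W\<^sup>H\<close> sends to the first coordinate axis.\<close>
lemma unitary_conjugate_first_col:
  assumes W: "unitary_mat (Suc n) W" and U: "unitary_mat (Suc n) U"
    and M: "M \<in> carrier_mat (Suc n) (Suc n)"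
    and colU: "col U 0 = c \<cdot>\<^sub>v x" and colW: "col W 0 = d \<cdot>\<^sub>v w" "d \<noteq> 0"
    and x: "x \<in> carrier_vec (Suc n)" and w: "w \<in> carrier_vec (Suc n)" and Mx: "M *\<^sub>v x = \<alpha> \<cdot>\<^sub>v w"
    and i: "i < n"
  shows "(mat_adjoint W * M * U) $$ (Suc i, 0) = 0"
proof -
  have cW: "W \<in> carrier_mat (Suc n) (Suc n)" "mat_adjoint W \<in> carrier_mat (Suc n) (Suc n)"
    and WW: "mat_adjoint W * W = 1\<^sub>m (Suc n)" and cU: "U \<in> carrier_mat (Suc n) (Suc n)"
    using W U by (auto simp: unitary_mat_def)
  have "(mat_adjoint W * M * U) $$ (Suc i, 0) = (mat_adjoint W * (M * U)) $$ (Suc i, 0)"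
    using cW cU M by (simp add: assoc_mult_mat[of _ "Suc n" "Suc n" _ "Suc n" _ "Suc n"])
  also have "\<dots> = row (mat_adjoint W) (Suc i) \<bullet> col (M * U) 0"
    using cW cU M i by (intro index_mult_mat) auto
  also have "col (M * U) 0 = M *\<^sub>v col U 0"
    using cU M by (intro col_mult2[of _ "Suc n" "Suc n" _ "Suc n"]) auto
  also have "\<dots> = c \<cdot>\<^sub>v (M *\<^sub>v x)"
    unfolding colU using M x by (intro mult_mat_vec) auto
  also have "\<dots> = (c * \<alpha> / d) \<cdot>\<^sub>v col W 0"
    unfolding Mx colW(1) using colW(2) by (simp add: smult_smult_assoc)
  also have "row (mat_adjoint W) (Suc i) \<bullet> \<dots> = (c * \<alpha> / d) * (row (mat_adjoint W) (Suc i) \<bullet> col W 0)"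
    using cW i by (intro scalar_prod_smult_distrib[of _ "Suc n"]) (auto simp: row_def col_def)
  also have "row (mat_adjoint W) (Suc i) \<bullet> col W 0 = (mat_adjoint W * W) $$ (Suc i, 0)"
    using cW i by (intro index_mult_mat(1)[symmetric]) auto
  also have "\<dots> = 0" unfolding WW using i by simp
  finally show ?thesis by simp
qed

text \<open>Bordering with the solution of the deflated problem of size \<open>n\<close> solves the problem of size
  \<open>n + 1\<close>.\<close>
lemma periodic_triangularization:
  assumes "\<And>k. 1 \<le> k \<Longrightarrow> k \<le> p \<Longrightarrow> M k \<in> carrier_mat n n \<and> N k \<in> carrier_mat n n"
  shows "\<exists>Q Z. Z (Suc p) = Z 1 \<and> (\<forall>k\<in>{1..Suc p}. unitary_mat n (Z k)) \<and> (\<forall>k\<in>{1..p}. unitary_mat n (Q k) \<and>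
    upper_triangular (mat_adjoint (Q k) * M k * Z k) \<and>
    upper_triangular (mat_adjoint (Q k) * N k * Z (Suc k)))"
  using assms
proof (induction n arbitrary: M N)
  case 0
  have "unitary_mat 0 (1\<^sub>m 0)" unfolding unitary_mat_def by (auto intro!: eq_matI)
  thus ?case
    by (intro exI[of _ "\<lambda>_. 1\<^sub>m 0"]) (auto simp: mat_adjoint_def)
next
  case (Suc n)
  let ?V = "carrier_vec (Suc n) - {0\<^sub>v (Suc n)} :: complex vec set"
  have MN: "M k \<in> carrier_mat (Suc n) (Suc n)" "N k \<in> carrier_mat (Suc n) (Suc n)"
    if "k \<in> {1..p}" for k
    using Suc.prems[of k] that by auto
  obtain z where z: "z (Suc p) = z 1" "\<And>k. k \<in> {1..Suc p} \<Longrightarrow> z k \<in> ?V"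
    "\<And>k. k \<in> {1..p} \<Longrightarrow> common_line (Suc n) (M k) (N k) (z k) (z (Suc k))"
    using cyclic_common_lines[of "Suc n" p M N] MN by auto
  have "\<forall>k\<in>{1..p}. \<exists>w \<alpha> \<beta>. w \<in> carrier_vec (Suc n) \<and> w \<noteq> 0\<^sub>v (Suc n) \<and>
     M k *\<^sub>v z k = \<alpha> \<cdot>\<^sub>v w \<and> N k *\<^sub>v z (Suc k) = \<beta> \<cdot>\<^sub>v w"
    using z(3) unfolding common_line_def by blast
  then obtain w \<alpha> \<beta> where w: "\<And>k. k \<in> {1..p} \<Longrightarrow> w k \<in> ?V"
    "\<And>k. k \<in> {1..p} \<Longrightarrow> M k *\<^sub>v z k = \<alpha> k \<cdot>\<^sub>v w k"
    "\<And>k. k \<in> {1..p} \<Longrightarrow> N k *\<^sub>v z (Suc k) = \<beta> k \<cdot>\<^sub>v w k"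
    by (metis DiffI singletonD)
  have "\<forall>v\<in>?V. \<exists>U c. unitary_mat (Suc n) U \<and> c \<noteq> 0 \<and> col U 0 = c \<cdot>\<^sub>v v"
    using unitary_mat_with_first_col by blast
  then obtain F c where F: "\<And>v. v \<in> ?V \<Longrightarrow> unitary_mat (Suc n) (F v)"
    "\<And>v. v \<in> ?V \<Longrightarrow> c v \<noteq> 0" "\<And>v. v \<in> ?V \<Longrightarrow> col (F v) 0 = c v \<cdot>\<^sub>v v"
    by metis
  \<comment> \<open>The unitary matrix is chosen as a function of the vector, so that \<open>z (p + 1) = z 1\<close> carries over
    to \<open>U\<close>.\<close>
  define U where "U k = F (z k)" for k
  define W where "W k = F (w k)" for k
  have U: "unitary_mat (Suc n) (U k)" if "k \<in> {1..Suc p}" for k using F z that by (simp add: U_def)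
  have W: "unitary_mat (Suc n) (W k)" if "k \<in> {1..p}" for k using F w that by (simp add: W_def)
  define M' where "M' k = mat_adjoint (W k) * M k * U k" for k
  define N' where "N' k = mat_adjoint (W k) * N k * U (Suc k)" for k
  have c: "U k \<in> carrier_mat (Suc n) (Suc n)" "U (Suc k) \<in> carrier_mat (Suc n) (Suc n)"
    "W k \<in> carrier_mat (Suc n) (Suc n)" "mat_adjoint (W k) \<in> carrier_mat (Suc n) (Suc n)"
    if "k \<in> {1..p}" for k
    using U[of k] U[of "Suc k"] W[OF that] that by (auto simp: unitary_mat_def)
  have c': "M' k \<in> carrier_mat (Suc n) (Suc n)" "N' k \<in> carrier_mat (Suc n) (Suc n)"
    if "k \<in> {1..p}" for k
    using c[OF that] MN[OF that] by (auto simp: M'_def N'_def)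
  have zero: "M' k $$ (Suc i, 0) = 0" "N' k $$ (Suc i, 0) = 0" if k: "k \<in> {1..p}" and i: "i < n" for k i
  proof -
    have k': "k \<in> {1..Suc p}" "Suc k \<in> {1..Suc p}" using k by auto
    note wk = w(1)[OF k] and zk = z(2)[OF k'(1)] and zk' = z(2)[OF k'(2)]
    show "M' k $$ (Suc i, 0) = 0" unfolding M'_def
      by (rule unitary_conjugate_first_col[OF W[OF k] U[OF k'(1)] MN(1)[OF k] _ _ _ _ _ w(2)[OF k] i])
        (use wk zk F in \<open>auto simp: U_def W_def\<close>)
    show "N' k $$ (Suc i, 0) = 0" unfolding N'_def
      by (rule unitary_conjugate_first_col[OF W[OF k] U[OF k'(2)] MN(2)[OF k] _ _ _ _ _ w(3)[OF k] i])
        (use wk zk' F in \<open>auto simp: U_def W_def\<close>)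
  qed
  have "\<exists>Q Z. Z (Suc p) = Z 1 \<and> (\<forall>k\<in>{1..Suc p}. unitary_mat n (Z k)) \<and>
    (\<forall>k\<in>{1..p}. unitary_mat n (Q k) \<and>
      upper_triangular (mat_adjoint (Q k) * deflate n (M' k) * Z k) \<and>
      upper_triangular (mat_adjoint (Q k) * deflate n (N' k) * Z (Suc k)))"
    by (rule Suc.IH) simp
  then obtain Q Z where QZ: "Z (Suc p) = Z 1" "\<And>k. k \<in> {1..Suc p} \<Longrightarrow> unitary_mat n (Z k)"
    "\<And>k. k \<in> {1..p} \<Longrightarrow> unitary_mat n (Q k)"
    "\<And>k. k \<in> {1..p} \<Longrightarrow> upper_triangular (mat_adjoint (Q k) * deflate n (M' k) * Z k)"
    "\<And>k. k \<in> {1..p} \<Longrightarrow> upper_triangular (mat_adjoint (Q k) * deflate n (N' k) * Z (Suc k))"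
    by blast
  have step: "mat_adjoint (W k * border n (Q k)) * X * (Y * border n B)
      = border n (mat_adjoint (Q k)) * (mat_adjoint (W k) * X * Y) * border n B"
    if k: "k \<in> {1..p}" and X: "X \<in> carrier_mat (Suc n) (Suc n)" "Y \<in> carrier_mat (Suc n) (Suc n)"
      "B \<in> carrier_mat n n" for k X Y B
  proof -
    have q: "Q k \<in> carrier_mat n n" using QZ(3)[OF k] by (simp add: unitary_mat_def)
    note cc = c(3,4)[OF k] border_carrier[OF q] border_carrier[OF X(3)]
      border_carrier[OF mat_adjoint_carrier[OF q]]
    show ?thesis
      using cc X by (simp add: mat_adjoint_mult[OF cc(1,3)] mat_adjoint_border[OF q]
          assoc_mult_mat[of _ "Suc n" "Suc n" _ "Suc n" _ "Suc n"]
          mult_carrier_mat[of _ "Suc n" "Suc n" _ "Suc n"])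
  qed
  show ?case
  proof (rule exI[of _ "\<lambda>k. W k * border n (Q k)"], rule exI[of _ "\<lambda>k. U k * border n (Z k)"],
      intro conjI ballI)
    show "U (Suc p) * border n (Z (Suc p)) = U 1 * border n (Z 1)"
      by (simp only: U_def z(1) QZ(1))
  next
    fix k assume k: "k \<in> {1..p}"
    have k': "k \<in> {1..Suc p}" "Suc k \<in> {1..Suc p}" using k by auto
    have cc: "Z k \<in> carrier_mat n n" "Z (Suc k) \<in> carrier_mat n n" "mat_adjoint (Q k) \<in> carrier_mat n n"
      using QZ(2)[OF k'(1)] QZ(2)[OF k'(2)] QZ(3)[OF k] by (auto simp: unitary_mat_def)
    show "upper_triangular (mat_adjoint (W k * border n (Q k)) * M k * (U k * border n (Z k)))"
      unfolding step[OF k MN(1)[OF k] c(1)[OF k] cc(1)]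
      using upper_triangular_deflation[OF c'(1)[OF k] zero(1)[OF k] cc(3,1) QZ(4)[OF k]]
      by (simp add: M'_def)
    show "upper_triangular (mat_adjoint (W k * border n (Q k)) * N k * (U (Suc k) * border n (Z (Suc k))))"
      unfolding step[OF k MN(2)[OF k] c(2)[OF k] cc(2)]
      using upper_triangular_deflation[OF c'(2)[OF k] zero(2)[OF k] cc(3,2) QZ(5)[OF k]]
      by (simp add: N'_def)
  qed (use U W QZ in \<open>auto intro!: unitary_mat_mult unitary_mat_border\<close>)
qed

theorem periodic_schur_exists:
  assumes "\<And>k. k \<in> {1..p} \<Longrightarrow> M k \<in> carrier_mat n n" "\<And>k. k \<in> {1..p} \<Longrightarrow> N k \<in> carrier_mat n n"
  shows "\<exists>Q Z T R. periodic_schur n p M N Q Z T R"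
proof -
  have "\<exists>Q Z. Z (Suc p) = Z 1 \<and> (\<forall>k\<in>{1..Suc p}. unitary_mat n (Z k)) \<and>
    (\<forall>k\<in>{1..p}. unitary_mat n (Q k) \<and> upper_triangular (mat_adjoint (Q k) * M k * Z k) \<and>
      upper_triangular (mat_adjoint (Q k) * N k * Z (Suc k)))"
    by (rule periodic_triangularization) (use assms in auto)
  then obtain Q Z where Z: "Z (Suc p) = Z 1" "\<And>k. k \<in> {1..Suc p} \<Longrightarrow> unitary_mat n (Z k)"
    and Q: "\<And>k. k \<in> {1..p} \<Longrightarrow> unitary_mat n (Q k) \<and>
      upper_triangular (mat_adjoint (Q k) * M k * Z k) \<and>
      upper_triangular (mat_adjoint (Q k) * N k * Z (Suc k))"
    by blast
  have "periodic_schur n p M N Q Z (\<lambda>k. mat_adjoint (Q k) * M k * Z k)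
      (\<lambda>k. mat_adjoint (Q k) * N k * Z (k + 1))"
    unfolding periodic_schur_def
  proof (intro conjI ballI)
    fix k assume k: "k \<in> {1..p}"
    show "unitary_mat n (Z k)" using Z(2)[of k] k by simp
  qed (use Z(1) Q in simp_all)
  thus ?thesis by blast
qed

section \<open>The criterion\<close>

text \<open>The unitary factors of \<open>B\<^sub>k\<close> are \<open>Q'\<^bsub>k-1\<^esub>\<close> and \<open>Z'\<^sub>k\<close>, since \<open>B\<^sub>k\<close> is the matrix \<open>N\<^bsub>k-1\<^esub>\<close> of the second
  formal product. This makes \<open>Q'\<^bsub>k-1\<^esub>\<close> the factor to be absorbed into \<open>X\<^sub>k\<close> both in \<open>X\<^sub>k B\<^sub>k\<close> and in
  \<open>X\<^sub>k D\<^bsub>k-1\<^esub>\<close>. The triangular factor of \<open>B\<^sub>k\<close> is \<open>R'\<^bsub>k-1\<^esub>\<close>, and the cyclic shift disappears in the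
  product over \<open>k\<close>.\<close>
lemma sylvester_nonsingular_iff_diagonals:
  assumes r: "r \<ge> 1"
    and car: "\<And>k. k \<in> {1..r} \<Longrightarrow> A k \<in> carrier_mat n n" "\<And>k. k \<in> {1..r} \<Longrightarrow> B k \<in> carrier_mat n n"
    "\<And>k. k \<in> {1..r} \<Longrightarrow> C k \<in> carrier_mat n n" "\<And>k. k \<in> {1..r} \<Longrightarrow> D k \<in> carrier_mat n n"
    and ps: "periodic_schur n r A C Q Z T R"
    and ps': "periodic_schur n r D (\<lambda>k. if k = r then B 1 else B (k + 1)) Q' Z' T' R'"
  shows "sylvester_nonsingular n r A B C D \<longleftrightarrow>
    (\<forall>i<n. \<forall>j<n. (\<Prod>k=1..r. T k $$ (i, i)) * (\<Prod>k=1..r. R' k $$ (j, j))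
       \<noteq> (\<Prod>k=1..r. R k $$ (i, i)) * (\<Prod>k=1..r. T' k $$ (j, j)))"
proof -
  let ?B = "\<lambda>k. if k = r then B 1 else B (k + 1)"
  have Zs: "Z (k + 1) = Z (cyc_succ r k)" "Z' (k + 1) = Z' (cyc_succ r k)" for k
    using ps ps' by (auto simp: periodic_schur_def cyc_succ_def)
  have u: "unitary_mat n (Q k)" "unitary_mat n (Z k)" "unitary_mat n (Q' k)" "unitary_mat n (Z' k)"
    and e: "mat_adjoint (Q k) * A k * Z k = T k" "mat_adjoint (Q k) * C k * Z (cyc_succ r k) = R k"
      "mat_adjoint (Q' k) * D k * Z' k = T' k" "mat_adjoint (Q' k) * ?B k * Z' (cyc_succ r k) = R' k"
    and t: "upper_triangular (T k)" "upper_triangular (R k)" "upper_triangular (T' k)"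
      "upper_triangular (R' k)" if "k \<in> {1..r}" for k
    using ps ps' that unfolding periodic_schur_def Zs by auto
  have Bp: "?B (cyc_pred r k) = B k" if "k \<in> {1..r}" for k
    using that by (auto simp: cyc_pred_def)
  define S where "S k = R' (cyc_pred r k)" for k
  have eS: "mat_adjoint (Q' (cyc_pred r k)) * B k * Z' k = S k" if k: "k \<in> {1..r}" for k
    using e(4)[OF cyc_range(2)[OF k]] unfolding Bp[OF k] S_def cyc_inverse(2)[OF k] .
  have tS: "upper_triangular (S k)" if "k \<in> {1..r}" for k
    using t(4)[OF cyc_range(2)[OF that]] by (simp add: S_def)
  have uc: "Q k \<in> carrier_mat n n" "Z k \<in> carrier_mat n n" "Q' k \<in> carrier_mat n n" "Z' k \<in> carrier_mat n n"
    if "k \<in> {1..r}" for k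
    using u[OF that] by (auto simp: unitary_mat_def)
  have cT: "T k \<in> carrier_mat n n" "R k \<in> carrier_mat n n" "T' k \<in> carrier_mat n n" "S k \<in> carrier_mat n n"
    if k: "k \<in> {1..r}" for k
    unfolding e(1)[OF k, symmetric] e(2)[OF k, symmetric] e(3)[OF k, symmetric]
      eS[OF k, symmetric]
    by (intro mult_carrier_mat[of _ n n] mat_adjoint_carrier car[OF k] uc[OF k]
        uc[OF cyc_range(1)[OF k]] uc[OF cyc_range(2)[OF k]])+
  have ip: "inverse_pair n (mat_adjoint (Q k)) (Q k)" "inverse_pair n (Z k) (mat_adjoint (Z k))"
    "inverse_pair n (mat_adjoint (Q' (cyc_pred r k))) (Q' (cyc_pred r k))"
    "inverse_pair n (Z' k) (mat_adjoint (Z' k))" if k: "k \<in> {1..r}" for k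
    by (intro inverse_pair_sym[OF unitary_mat_inverse_pair] unitary_mat_inverse_pair u[OF k]
        u[OF cyc_range(2)[OF k]])+
  have "sylvester_nonsingular n r A B C D \<longleftrightarrow>
    sylvester_nonsingular n r (\<lambda>k. mat_adjoint (Q k) * A k * Z k)
      (\<lambda>k. mat_adjoint (Q' (cyc_pred r k)) * B k * Z' k)
      (\<lambda>k. mat_adjoint (Q k) * C k * Z (cyc_succ r k))
      (\<lambda>k. mat_adjoint (Q' (cyc_pred r (cyc_succ r k))) * D k * Z' k)"
    by (rule sylvester_nonsingular_transform[symmetric, OF r, where P' = Q
          and U' = "\<lambda>k. mat_adjoint (Z k)" and V' = "\<lambda>k. Q' (cyc_pred r k)"
          and W' = "\<lambda>k. mat_adjoint (Z' k)"])
      (fact car ip)+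
  also have "\<dots> \<longleftrightarrow> sylvester_nonsingular n r T S R T'"
    by (rule sylvester_nonsingular_cong[OF r]) (simp_all only: e eS cyc_inverse)
  also have "\<dots> \<longleftrightarrow> (\<forall>i<n. \<forall>j<n. (\<Prod>k=1..r. T k $$ (i, i)) * (\<Prod>k=1..r. S k $$ (j, j))
       \<noteq> (\<Prod>k=1..r. R k $$ (i, i)) * (\<Prod>k=1..r. T' k $$ (j, j)))"
  proof (subst sylvester_nonsingular_iff_trivial_kernel[OF r])
    show "trivial_kernel (sylvester_coeff r T S R T') (entry_set n r) \<longleftrightarrow>
      (\<forall>i<n. \<forall>j<n. (\<Prod>k=1..r. T k $$ (i, i)) * (\<Prod>k=1..r. S k $$ (j, j))
         \<noteq> (\<Prod>k=1..r. R k $$ (i, i)) * (\<Prod>k=1..r. T' k $$ (j, j)))"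
      by (rule trivial_kernel_upper_triangular[OF r]) (use cT t tS in blast)+
  qed (use cT in blast)+
  finally show ?thesis unfolding S_def prod_cyc_pred[of "\<lambda>k. R' k $$ (_, _)"] .
qed

lemma ext_quotient_eq_iff:
  assumes "\<not> (a = 0 \<and> b = 0)" "\<not> (c = 0 \<and> d = 0)"
  shows "ext_quotient a b = ext_quotient c d \<longleftrightarrow> a * d = b * c"
  using assms by (auto simp: ext_quotient_def field_simps)

theorem theorem5:
  fixes n r :: nat and A B C D :: "nat \<Rightarrow> complex mat"
  assumes "n \<ge> 1" and "r \<ge> 1"
    and "\<And>k. k \<in> {1..r} \<Longrightarrow> A k \<in> carrier_mat n n"
    and "\<And>k. k \<in> {1..r} \<Longrightarrow> B k \<in> carrier_mat n n"
    and "\<And>k. k \<in> {1..r} \<Longrightarrow> C k \<in> carrier_mat n n"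
    and "\<And>k. k \<in> {1..r} \<Longrightarrow> D k \<in> carrier_mat n n"
  defines "B' \<equiv> (\<lambda>k. if k = r then B 1 else B (k + 1))"
  shows "sylvester_nonsingular n r A B C D \<longleftrightarrow>
    formal_regular n r A C \<and> formal_regular n r D B' \<and>
    formal_spectrum n r A C \<inter> formal_spectrum n r D B' = {}"
proof -
  have main: "sylvester_nonsingular n r A B C D \<longleftrightarrow>
    (\<forall>i<n. \<forall>j<n. (\<Prod>k=1..r. T k $$ (i, i)) * (\<Prod>k=1..r. R' k $$ (j, j))
       \<noteq> (\<Prod>k=1..r. R k $$ (i, i)) * (\<Prod>k=1..r. T' k $$ (j, j)))"
    if "periodic_schur n r A C Q Z T R" "periodic_schur n r D B' Q' Z' T' R'"
    for Q Z T R Q' Z' T' R'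
    by (rule sylvester_nonsingular_iff_diagonals[OF assms(2) _ _ _ _ that(1)
          that(2)[unfolded B'_def]]) (fact assms)+
  have B': "B' k \<in> carrier_mat n n" if "k \<in> {1..r}" for k
    using assms(4)[of 1] assms(4)[of "k + 1"] that by (auto simp: B'_def)
  obtain Q Z T R where ps: "periodic_schur n r A C Q Z T R"
    using periodic_schur_exists[of r A n C] assms(3,5) by blast
  obtain Q' Z' T' R' where ps': "periodic_schur n r D B' Q' Z' T' R'"
    using periodic_schur_exists[of r D n B'] assms(6) B' by blast
  have n: "0 < n" using assms(1) by simp
  show ?thesis
  proof (intro iffI conjI)
    assume ns: "sylvester_nonsingular n r A B C D"
    show regA: "formal_regular n r A C"
      unfolding formal_regular_def formal_singular_def
    proof safe
      fix Q Z T R i assume s: "periodic_schur n r A C Q Z T R" "i < n"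
        and "(\<Prod>k=1..r. T k $$ (i, i)) = 0" "(\<Prod>k=1..r. R k $$ (i, i)) = 0"
      with main[OF s(1) ps', THEN iffD1, OF ns, rule_format, OF s(2) n] show False
        by (metis mult_zero_left)
    qed
    show regD: "formal_regular n r D B'"
      unfolding formal_regular_def formal_singular_def
    proof safe
      fix Q Z T' R' i assume s: "periodic_schur n r D B' Q Z T' R'" "i < n"
        and "(\<Prod>k=1..r. T' k $$ (i, i)) = 0" "(\<Prod>k=1..r. R' k $$ (i, i)) = 0"
      with main[OF ps s(1), THEN iffD1, OF ns, rule_format, OF n s(2)] show False
        by (metis mult_zero_right)
    qed
    show "formal_spectrum n r A C \<inter> formal_spectrum n r D B' = {}"
    proof (rule equals0I)
      fix x assume "x \<in> formal_spectrum n r A C \<inter> formal_spectrum n r D B'"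
      then obtain Q Z T R i Q' Z' T' R' j where
        s: "periodic_schur n r A C Q Z T R" "i < n" "periodic_schur n r D B' Q' Z' T' R'" "j < n"
        and x: "x = ext_quotient (\<Prod>k=1..r. T k $$ (i, i)) (\<Prod>k=1..r. R k $$ (i, i))"
          "x = ext_quotient (\<Prod>k=1..r. T' k $$ (j, j)) (\<Prod>k=1..r. R' k $$ (j, j))"
        unfolding formal_spectrum_def by blast
      have "\<not> ((\<Prod>k=1..r. T k $$ (i, i)) = 0 \<and> (\<Prod>k=1..r. R k $$ (i, i)) = 0)"
        "\<not> ((\<Prod>k=1..r. T' k $$ (j, j)) = 0 \<and> (\<Prod>k=1..r. R' k $$ (j, j)) = 0)"
        using regA regD s unfolding formal_regular_def formal_singular_def by blast+
      from ext_quotient_eq_iff[OF this] x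
      have "(\<Prod>k=1..r. T k $$ (i, i)) * (\<Prod>k=1..r. R' k $$ (j, j))
        = (\<Prod>k=1..r. R k $$ (i, i)) * (\<Prod>k=1..r. T' k $$ (j, j))" by metis
      with main[OF s(1,3)] ns s show False by blast
    qed
  next
    assume h: "formal_regular n r A C \<and> formal_regular n r D B' \<and>
      formal_spectrum n r A C \<inter> formal_spectrum n r D B' = {}"
    show "sylvester_nonsingular n r A B C D"
      unfolding main[OF ps ps']
    proof (intro allI impI)
      fix i j assume ij: "i < n" "j < n"
      have nz: "\<not> ((\<Prod>k=1..r. T k $$ (i, i)) = 0 \<and> (\<Prod>k=1..r. R k $$ (i, i)) = 0)"
        "\<not> ((\<Prod>k=1..r. T' k $$ (j, j)) = 0 \<and> (\<Prod>k=1..r. R' k $$ (j, j)) = 0)"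
        using h ps ps' ij unfolding formal_regular_def formal_singular_def by blast+
      have "ext_quotient (\<Prod>k=1..r. T k $$ (i, i)) (\<Prod>k=1..r. R k $$ (i, i)) \<in> formal_spectrum n r A C"
        "ext_quotient (\<Prod>k=1..r. T' k $$ (j, j)) (\<Prod>k=1..r. R' k $$ (j, j)) \<in> formal_spectrum n r D B'"
        using ps ps' ij unfolding formal_spectrum_def by blast+
      with h have "ext_quotient (\<Prod>k=1..r. T k $$ (i, i)) (\<Prod>k=1..r. R k $$ (i, i))
        \<noteq> ext_quotient (\<Prod>k=1..r. T' k $$ (j, j)) (\<Prod>k=1..r. R' k $$ (j, j))" by auto
      thus "(\<Prod>k=1..r. T k $$ (i, i)) * (\<Prod>k=1..r. R' k $$ (j, j))
        \<noteq> (\<Prod>k=1..r. R k $$ (i, i)) * (\<Prod>k=1..r. T' k $$ (j, j))"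
        unfolding ext_quotient_eq_iff[OF nz] .
    qed
  qed
qed

end
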